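(* There is a complete metric measure space $(X,d,\mu)$ and a function $f\in L^1(\mu)$ such that $Mf(x)<|f|(x)$ on a set of positive $\mu$-measure. In fact, $X$ can be taken to be an infinite dimensional separable Hilbert space (with its norm metric), and $\mu$ a Gaussian measure on $X$.
   Context: Closed balls are $B^{cl}(x,r):=\{y\in X: d(x,y)\le r\}$, $r>0$. Metric measure space: $(X,d)$ is a metric space and $\mu$ is a Borel measure (or the completion of one), not identically $0$, assigning finite measure to bounded Borel sets, and $\tau$-additive, meaning that for every collection $\{U_\alpha:\alpha\in\Lambda\}$ of open sets, $\mu(\cup_\alpha U_\alpha)=\sup \mu(\cup_{i=1}^n U_{\alpha_i})$, the supremum being over all finite subcollections. (Every Borel measure on a separable metric space is $\tau$-additive.) It is complete if the metric space $(X,d)$ is complete. The centered Hardy-Littlewood maximal function is $$Mf(x):=\sup_{\{r>0:\ 0<\mu(B^{cl}(x,r))\}}\frac{1}{\mu(B^{cl}(x,r))}\int_{B^{cl}(x,r)}|f|\,d\mu.$$ *)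

theory Defs
  imports "HOL-Probability.Probability"
begin

section \<open>The real Hilbert space of square-summable sequences\<close>

typedef ell2 = "{x :: nat \<Rightarrow> real. summable (\<lambda>n. (x n)\<^sup>2)}"
  morphisms ell2_nth Abs_ell2
  by (rule exI[of _ "\<lambda>_. 0"]) simp

setup_lifting type_definition_ell2

lemma ell2_summable_square: "summable (\<lambda>n. (ell2_nth x n)\<^sup>2)"
  using ell2_nth[of x] by simp

lemma summable_mult_square:
  fixes x y :: "nat \<Rightarrow> real"
  assumes "summable (\<lambda>n. (x n)\<^sup>2)" "summable (\<lambda>n. (y n)\<^sup>2)"
  shows "summable (\<lambda>n. x n * y n)"
proof (rule summable_comparison_test')
  show "summable (\<lambda>n. (x n)\<^sup>2 + (y n)\<^sup>2)"
    using assms by (rule summable_add)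
  show "norm (x n * y n) \<le> (x n)\<^sup>2 + (y n)\<^sup>2" for n
    using sum_squares_bound[of "\<bar>x n\<bar>" "\<bar>y n\<bar>"] mult_nonneg_nonneg[OF abs_ge_zero[of "x n"] abs_ge_zero[of "y n"]]
    unfolding real_norm_def abs_mult power2_abs by linarith
qed

lemma summable_add_square:
  fixes x y :: "nat \<Rightarrow> real"
  assumes "summable (\<lambda>n. (x n)\<^sup>2)" "summable (\<lambda>n. (y n)\<^sup>2)"
  shows "summable (\<lambda>n. (x n + y n)\<^sup>2)"
proof -
  have "summable (\<lambda>n. (x n)\<^sup>2 + (y n)\<^sup>2 + 2 * (x n * y n))"
    by (intro summable_add summable_mult summable_mult_square assms)
  then show ?thesis
    by (simp add: power2_sum mult.assoc)
qed

lemma summable_scale_square: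
  fixes x :: "nat \<Rightarrow> real"
  assumes "summable (\<lambda>n. (x n)\<^sup>2)"
  shows "summable (\<lambda>n. (c * x n)\<^sup>2)"
  using summable_mult[OF assms, of "c\<^sup>2"] by (simp add: power_mult_distrib)

lemma summable_diff_square:
  fixes x y :: "nat \<Rightarrow> real"
  assumes "summable (\<lambda>n. (x n)\<^sup>2)" "summable (\<lambda>n. (y n)\<^sup>2)"
  shows "summable (\<lambda>n. (x n - y n)\<^sup>2)"
  using summable_add_square[OF assms(1) summable_scale_square[OF assms(2), of "-1"]] by simp

instantiation ell2 :: real_inner
begin

lift_definition zero_ell2 :: ell2 is "\<lambda>_. 0"
  by simp

lift_definition plus_ell2 :: "ell2 \<Rightarrow> ell2 \<Rightarrow> ell2" is "\<lambda>x y n. x n + y n"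
  by (rule summable_add_square)

lift_definition minus_ell2 :: "ell2 \<Rightarrow> ell2 \<Rightarrow> ell2" is "\<lambda>x y n. x n - y n"
  by (rule summable_diff_square)

lift_definition uminus_ell2 :: "ell2 \<Rightarrow> ell2" is "\<lambda>x n. - x n"
  by simp

lift_definition scaleR_ell2 :: "real \<Rightarrow> ell2 \<Rightarrow> ell2" is "\<lambda>c x n. c * x n"
  by (rule summable_scale_square)

definition inner_ell2 :: "ell2 \<Rightarrow> ell2 \<Rightarrow> real"
  where "inner_ell2 x y = (\<Sum>n. ell2_nth x n * ell2_nth y n)"

definition norm_ell2 :: "ell2 \<Rightarrow> real"
  where "norm_ell2 x = sqrt (inner x x)"

definition dist_ell2 :: "ell2 \<Rightarrow> ell2 \<Rightarrow> real"
  where "dist_ell2 x y = norm (x - y)"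

definition sgn_ell2 :: "ell2 \<Rightarrow> ell2"
  where "sgn_ell2 x = inverse (norm x) *\<^sub>R x"

definition uniformity_ell2 :: "(ell2 \<times> ell2) filter"
  where "uniformity_ell2 = (INF e\<in>{0<..}. principal {(x, y). dist x y < e})"

definition open_ell2 :: "ell2 set \<Rightarrow> bool"
  where "open_ell2 U \<longleftrightarrow> (\<forall>x\<in>U. eventually (\<lambda>(x', y). x' = x \<longrightarrow> y \<in> U) uniformity)"

instance
proof
  fix x y z :: ell2 and a b :: real
  show "x + y + z = x + (y + z)" "x + y = y + x" "0 + x = x" "- x + x = 0" "x - y = x + - y"
    "a *\<^sub>R (x + y) = a *\<^sub>R x + a *\<^sub>R y" "(a + b) *\<^sub>R x = a *\<^sub>R x + b *\<^sub>R x"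
    "a *\<^sub>R b *\<^sub>R x = (a * b) *\<^sub>R x" "1 *\<^sub>R x = x"
    by (transfer; simp add: fun_eq_iff algebra_simps)+
  show "dist x y = norm (x - y)" "sgn x = inverse (norm x) *\<^sub>R x"
    "(uniformity :: (ell2 \<times> ell2) filter) = (INF e\<in>{0<..}. principal {(x, y). dist x y < e})"
    "norm x = sqrt (inner x x)"
    by (simp_all add: dist_ell2_def sgn_ell2_def uniformity_ell2_def norm_ell2_def)
  show "open U \<longleftrightarrow> (\<forall>x\<in>U. eventually (\<lambda>(x', y). x' = x \<longrightarrow> y \<in> U) uniformity)"
    for U :: "ell2 set"
    by (simp add: open_ell2_def)
  have sm: "summable (\<lambda>n. ell2_nth u n * ell2_nth v n)" for u v
    by (intro summable_mult_square ell2_summable_square)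
  show "inner x y = inner y x"
    by (simp add: inner_ell2_def mult.commute)
  show "inner (x + y) z = inner x z + inner y z"
    by (simp add: inner_ell2_def plus_ell2.rep_eq distrib_right suminf_add sm)
  show "inner (a *\<^sub>R x) y = a * inner x y"
    by (simp add: inner_ell2_def scaleR_ell2.rep_eq mult.assoc suminf_mult sm)
  show "0 \<le> inner x x"
    unfolding inner_ell2_def by (intro suminf_nonneg sm) simp
  have "inner x x = 0 \<longleftrightarrow> (\<forall>n. ell2_nth x n * ell2_nth x n = 0)"
    unfolding inner_ell2_def by (intro suminf_eq_zero_iff sm) simp
  then show "inner x x = 0 \<longleftrightarrow> x = 0"
    by (simp add: ell2_nth_inject[symmetric] zero_ell2.rep_eq fun_eq_iff)
qed

end

lemma norm_ell2_square: "(norm x)\<^sup>2 = (\<Sum>n. (ell2_nth x n)\<^sup>2)"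
  unfolding power2_norm_eq_inner inner_ell2_def by (simp add: power2_eq_square)

lemma sum_square_le_norm_ell2: "(\<Sum>n<k. (ell2_nth x n)\<^sup>2) \<le> (norm x)\<^sup>2"
  unfolding norm_ell2_square by (intro sum_le_suminf ell2_summable_square) auto

lemma ell2_nth_le_norm: "\<bar>ell2_nth x n\<bar> \<le> norm x"
proof -
  have "(ell2_nth x n)\<^sup>2 \<le> (\<Sum>i<Suc n. (ell2_nth x i)\<^sup>2)"
    by (simp add: sum_nonneg)
  also note sum_square_le_norm_ell2
  finally show ?thesis
    by (metis abs_le_square_iff abs_norm_cancel)
qed

instance ell2 :: complete_space
proof
  fix X :: "nat \<Rightarrow> ell2"
  assume X: "Cauchy X"
  have "convergent (\<lambda>k. ell2_nth (X k) n)" for n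
  proof (rule real_Cauchy_convergent, rule CauchyI)
    fix e :: real
    assume "0 < e"
    then obtain N where N: "\<forall>i\<ge>N. \<forall>j\<ge>N. norm (X i - X j) < e"
      using CauchyD[OF X] by blast
    have "norm (ell2_nth (X i) n - ell2_nth (X j) n) \<le> norm (X i - X j)" for i j
      using ell2_nth_le_norm[of "X i - X j" n] by (simp add: minus_ell2.rep_eq)
    then show "\<exists>N. \<forall>i\<ge>N. \<forall>j\<ge>N. norm (ell2_nth (X i) n - ell2_nth (X j) n) < e"
      using N by (meson le_less_trans)
  qed
  then obtain l where l: "\<And>n. (\<lambda>k. ell2_nth (X k) n) \<longlonglongrightarrow> l n"
    unfolding convergent_def by metis
  have ev: "\<exists>N. \<forall>i\<ge>N. \<forall>K. (\<Sum>n<K. (ell2_nth (X i) n - l n)\<^sup>2) \<le> e\<^sup>2" if e: "0 < e" for e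
  proof -
    obtain N where N: "\<forall>i\<ge>N. \<forall>j\<ge>N. norm (X i - X j) < e"
      using CauchyD[OF X e] by blast
    have "(\<Sum>n<K. (ell2_nth (X i) n - l n)\<^sup>2) \<le> e\<^sup>2" if "i \<ge> N" for i K
    proof (rule LIMSEQ_le_const2)
      show "(\<lambda>j. \<Sum>n<K. (ell2_nth (X i) n - ell2_nth (X j) n)\<^sup>2)
          \<longlonglongrightarrow> (\<Sum>n<K. (ell2_nth (X i) n - l n)\<^sup>2)"
        by (intro tendsto_intros l)
      have "(\<Sum>n<K. (ell2_nth (X i) n - ell2_nth (X j) n)\<^sup>2) \<le> e\<^sup>2" if "j \<ge> N" for j
      proof -
        have "(\<Sum>n<K. (ell2_nth (X i) n - ell2_nth (X j) n)\<^sup>2) \<le> (norm (X i - X j))\<^sup>2"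
          using sum_square_le_norm_ell2[of "X i - X j" K] by (simp add: minus_ell2.rep_eq)
        also have "\<dots> \<le> e\<^sup>2"
          using N \<open>i \<ge> N\<close> that by (intro power_mono) (auto intro: less_imp_le)
        finally show ?thesis .
      qed
      then show "\<exists>M. \<forall>j\<ge>M. (\<Sum>n<K. (ell2_nth (X i) n - ell2_nth (X j) n)\<^sup>2) \<le> e\<^sup>2"
        by blast
    qed
    then show ?thesis
      by blast
  qed
  have sm: "summable (\<lambda>n. (ell2_nth (X i) n - l n)\<^sup>2)"
    if "\<forall>K. (\<Sum>n<K. (ell2_nth (X i) n - l n)\<^sup>2) \<le> e" for i e
    using that by (intro summableI_nonneg_bounded[where x = e]) auto
  obtain i where i: "summable (\<lambda>n. (ell2_nth (X i) n - l n)\<^sup>2)"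
    using ev[of 1] sm by (metis order_refl zero_less_one)
  have "summable (\<lambda>n. (l n)\<^sup>2)"
    using summable_diff_square[OF ell2_summable_square[of "X i"] i] by simp
  then have L: "ell2_nth (Abs_ell2 l) = l"
    by (simp add: Abs_ell2_inverse)
  have "X \<longlonglongrightarrow> Abs_ell2 l"
  proof (rule LIMSEQ_I)
    fix e :: real
    assume "0 < e"
    then obtain N where N: "\<forall>i\<ge>N. \<forall>K. (\<Sum>n<K. (ell2_nth (X i) n - l n)\<^sup>2) \<le> (e / 2)\<^sup>2"
      using ev[of "e / 2"] by auto
    have "norm (X i - Abs_ell2 l) < e" if "i \<ge> N" for i
    proof -
      have "(norm (X i - Abs_ell2 l))\<^sup>2 \<le> (e / 2)\<^sup>2"
        unfolding norm_ell2_square minus_ell2.rep_eq L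
        using N that by (intro suminf_le_const sm[where e = "(e / 2)\<^sup>2"]) auto
      then have "norm (X i - Abs_ell2 l) \<le> e / 2"
        by (rule power2_le_imp_le) (use \<open>0 < e\<close> in simp)
      then show ?thesis
        using \<open>0 < e\<close> by simp
    qed
    then show "\<exists>N. \<forall>i\<ge>N. norm (X i - Abs_ell2 l) < e"
      by blast
  qed
  then show "convergent X"
    by (rule convergentI)
qed


section \<open>Metric measure spaces and Gaussian measures\<close>

definition tau_additive :: "'a::topological_space measure \<Rightarrow> bool"
  where "tau_additive \<mu> \<longleftrightarrow>
    (\<forall>\<U>. (\<forall>U\<in>\<U>. open U) \<longrightarrow>
      emeasure \<mu> (\<Union>\<U>) = (SUP \<F>\<in>{\<F>. finite \<F> \<and> \<F> \<subseteq> \<U>}. emeasure \<mu> (\<Union>\<F>)))"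

definition metric_measure_space :: "'a::metric_space measure \<Rightarrow> bool"
  where "metric_measure_space \<mu> \<longleftrightarrow>
    (\<exists>\<nu>. sets \<nu> = sets borel \<and> (\<mu> = \<nu> \<or> \<mu> = completion \<nu>)) \<and>
    emeasure \<mu> (space \<mu>) \<noteq> 0 \<and>
    (\<forall>A\<in>sets borel. bounded A \<longrightarrow> emeasure \<mu> A < \<infinity>) \<and>
    tau_additive \<mu>"

text \<open>
  A Borel probability measure is Gaussian if every continuous linear functional has a
  one-dimensional normal distribution under it. As usual, a point mass counts as the normal
  distribution of standard deviation 0; it has to be listed separately because
  \<^const>\<open>normal_density\<close> is meaningful only for positive standard deviation.
\<close>

definition gaussian_measure :: "'a::real_normed_vector measure \<Rightarrow> bool"
  where "gaussian_measure \<mu> \<longleftrightarrow>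
    prob_space \<mu> \<and> sets \<mu> = sets borel \<and>
    (\<forall>l :: 'a \<Rightarrow> real. bounded_linear l \<longrightarrow>
      (\<exists>m. distr \<mu> borel l = return borel m) \<or>
      (\<exists>m \<sigma>. 0 < \<sigma> \<and> distr \<mu> borel l = density lborel (\<lambda>t. ennreal (normal_density m \<sigma> t))))"


section \<open>The centered maximal function\<close>

definition centered_maximal :: "'a::metric_space measure \<Rightarrow> ('a \<Rightarrow> real) \<Rightarrow> 'a \<Rightarrow> ennreal"
  where "centered_maximal \<mu> f x =
    (SUP r\<in>{r. 0 < r \<and> 0 < emeasure \<mu> (cball x r)}.
      (\<integral>\<^sup>+y\<in>cball x r. ennreal \<bar>f y\<bar> \<partial>\<mu>) / emeasure \<mu> (cball x r))"

end

theory Submission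
  imports Defs
begin

text \<open>
  Let \<open>\<mu>\<close> be the Gaussian product measure whose coordinates are grouped into blocks of
  \<open>N\<^sub>k = 10\<^sup>8 2\<^sup>k\<close> independent coordinates with total variance \<open>s\<^sub>k = 16\<^sup>-\<^sup>k\<close>. By Chebyshev, the set \<open>C\<close>
  of points \<open>y\<close> with \<open>\<bar>\<parallel>y\<^sub>k\<parallel>\<^sup>2 - s\<^sub>k\<bar> \<le> s\<^sub>k / 4000\<close> in every block has positive measure. However, inside a small
  ball \<open>B(x,r)\<close> with \<open>x \<in> C\<close> and \<open>s\<^sub>k\<^sub>+\<^sub>1 \<le> r\<^sup>2 \<le> s\<^sub>k\<close> the mass prefers points whose \<open>k\<close>-th block is shorter than
  that: moving the \<open>k\<close>-th block a little in the direction \<open>-x\<^sub>k\<close> increases the Gaussian density by more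
  than is lost by contracting the blocks \<open>0, \<dots>, k + 1\<close> slightly towards \<open>x\<close>, and the contraction keeps
  the point in the ball. This gives an affine map of \<open>C \<inter> B(x,r)\<close> into \<open>B(x,r) - C\<close> that does not
  decrease the measure, so \<open>C\<close> fills at most half of \<open>B(x,r)\<close>, and \<open>f\<close> is the indicator of \<open>C\<close>.
\<close>

section \<open>The topology of \<open>ell2\<close>\<close>

lift_definition ell2_unit :: "nat \<Rightarrow> ell2" is "\<lambda>n i. if i = n then 1 else 0"
proof -
  fix n :: nat
  have "(\<lambda>i. (if i = n then 1 else 0 :: real)\<^sup>2) = (\<lambda>i. if i = n then 1 else 0)"
    by auto
  then show "summable (\<lambda>i. (if i = n then 1 else 0 :: real)\<^sup>2)"
    using summable_single[of n "\<lambda>_. 1 :: real"] by simp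
qed

lemma ell2_nth_zero [simp]: "ell2_nth 0 i = 0"
  by (simp add: zero_ell2.rep_eq)

lemma ell2_nth_add [simp]: "ell2_nth (x + y) i = ell2_nth x i + ell2_nth y i"
  by (simp add: plus_ell2.rep_eq)

lemma ell2_nth_diff [simp]: "ell2_nth (x - y) i = ell2_nth x i - ell2_nth y i"
  by (simp add: minus_ell2.rep_eq)

lemma ell2_nth_scaleR [simp]: "ell2_nth (c *\<^sub>R x) i = c * ell2_nth x i"
  by (simp add: scaleR_ell2.rep_eq)

lemma ell2_nth_sum: "ell2_nth (sum f I) i = (\<Sum>j\<in>I. ell2_nth (f j) i)"
  by (induction I rule: infinite_finite_induct) simp_all

lemma bounded_linear_ell2_nth: "bounded_linear (\<lambda>x. ell2_nth x i)"
  by (rule bounded_linear_intro[where K = 1]) (simp_all add: ell2_nth_le_norm)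

lemma ell2_nth_partial_sum:
  "ell2_nth (\<Sum>i<n. c i *\<^sub>R ell2_unit i) j = (if j < n then c j else 0)"
proof -
  have "ell2_nth (\<Sum>i<n. c i *\<^sub>R ell2_unit i) j = (\<Sum>i<n. if i = j then c i else 0)"
    unfolding ell2_nth_sum by (intro sum.cong) (auto simp: ell2_unit.rep_eq)
  then show ?thesis
    by simp
qed

lemma inner_ell2_unit: "inner x (ell2_unit n) = ell2_nth x n"
proof -
  have "(\<lambda>i. ell2_nth x i * (if i = n then 1 else 0)) = (\<lambda>i. if i = n then ell2_nth x i else 0)"
    by auto
  then show ?thesis
    using sums_single[of n "ell2_nth x"] by (simp add: inner_ell2_def ell2_unit.rep_eq sums_iff)
qed

lemma norm_ell2_unit [simp]: "norm (ell2_unit n) = 1"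
  by (simp add: norm_eq_sqrt_inner inner_ell2_unit ell2_unit.rep_eq)

lemma ell2_expansion: "(\<lambda>n. \<Sum>i<n. ell2_nth x i *\<^sub>R ell2_unit i) \<longlonglongrightarrow> x"
proof -
  have eq: "(norm (x - (\<Sum>i<n. ell2_nth x i *\<^sub>R ell2_unit i)))\<^sup>2
      = (norm x)\<^sup>2 - (\<Sum>i<n. (ell2_nth x i)\<^sup>2)" (is "_ = ?r n") for n
  proof -
    let ?y = "x - (\<Sum>i<n. ell2_nth x i *\<^sub>R ell2_unit i)"
    have "(norm ?y)\<^sup>2 = (\<Sum>i. (ell2_nth ?y (i + n))\<^sup>2) + (\<Sum>i<n. (ell2_nth ?y i)\<^sup>2)"
      unfolding norm_ell2_square by (rule suminf_split_initial_segment) (rule ell2_summable_square)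
    also have "\<dots> = (\<Sum>i. (ell2_nth x (i + n))\<^sup>2)"
      by (simp add: ell2_nth_partial_sum)
    also have "\<dots> = (norm x)\<^sup>2 - (\<Sum>i<n. (ell2_nth x i)\<^sup>2)"
      unfolding norm_ell2_square by (rule suminf_minus_initial_segment) (rule ell2_summable_square)
    finally show ?thesis .
  qed
  have "?r \<longlonglongrightarrow> (norm x)\<^sup>2 - (norm x)\<^sup>2"
    unfolding norm_ell2_square
    by (intro tendsto_intros summable_LIMSEQ ell2_summable_square)
  then have "(\<lambda>n. (norm (x - (\<Sum>i<n. ell2_nth x i *\<^sub>R ell2_unit i)))\<^sup>2) \<longlonglongrightarrow> 0"
    by (simp add: eq)
  then have "(\<lambda>n. sqrt ((norm (x - (\<Sum>i<n. ell2_nth x i *\<^sub>R ell2_unit i)))\<^sup>2)) \<longlonglongrightarrow> sqrt 0"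
    by (rule tendsto_real_sqrt)
  then have "(\<lambda>n. norm ((\<Sum>i<n. ell2_nth x i *\<^sub>R ell2_unit i) - x)) \<longlonglongrightarrow> 0"
    by (simp add: norm_minus_commute)
  then show ?thesis
    by (simp add: LIM_zero_iff tendsto_norm_zero_iff)
qed

definition ell2_rational :: "ell2 set"
  where "ell2_rational = range (\<lambda>qs :: rat list. \<Sum>i<length qs. of_rat (qs ! i) *\<^sub>R ell2_unit i)"

lemma countable_ell2_rational: "countable ell2_rational"
  by (simp add: ell2_rational_def)

lemma ell2_rational_dense:
  assumes "0 < e"
  shows "\<exists>d\<in>ell2_rational. dist d x < e"
proof -
  obtain n where n: "norm ((\<Sum>i<n. ell2_nth x i *\<^sub>R ell2_unit i) - x) < e / 2"
    using LIMSEQ_D[OF ell2_expansion, of "e / 2" x] assms by auto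
  have "\<exists>q. \<bar>of_rat q - ell2_nth x i\<bar> < e / (2 * real (Suc n))" for i
  proof -
    have "ell2_nth x i < ell2_nth x i + e / (2 * real (Suc n))"
      using assms by simp
    from of_rat_dense[OF this] obtain q :: rat
      where "ell2_nth x i < of_rat q" "of_rat q < ell2_nth x i + e / (2 * real (Suc n))"
      by blast
    then show ?thesis
      by (intro exI[of _ q]) (simp add: abs_if)
  qed
  then obtain q :: "nat \<Rightarrow> rat" where q: "\<And>i. \<bar>of_rat (q i) - ell2_nth x i\<bar> < e / (2 * real (Suc n))"
    by metis
  let ?d = "\<Sum>i<n. of_rat (q i) *\<^sub>R ell2_unit i"
  have "?d = (\<Sum>i<length (map q [0..<n]). of_rat (map q [0..<n] ! i) *\<^sub>R ell2_unit i)"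
    by simp
  then have "?d \<in> ell2_rational"
    unfolding ell2_rational_def by blast
  moreover have "dist ?d x < e"
  proof -
    have "norm (?d - (\<Sum>i<n. ell2_nth x i *\<^sub>R ell2_unit i))
        = norm (\<Sum>i<n. (of_rat (q i) - ell2_nth x i) *\<^sub>R ell2_unit i)"
      by (simp add: sum_subtractf scaleR_diff_left)
    also have "\<dots> \<le> (\<Sum>i<n. e / (2 * real (Suc n)))"
      by (intro sum_norm_le) (use q in \<open>simp add: less_imp_le\<close>)
    also have "\<dots> \<le> e / 2"
      using assms by (simp add: field_simps)
    finally show ?thesis
      using n norm_triangle_ineq[of "?d - (\<Sum>i<n. ell2_nth x i *\<^sub>R ell2_unit i)" "(\<Sum>i<n. ell2_nth x i *\<^sub>R ell2_unit i) - x"]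
      by (simp add: dist_norm)
  qed
  ultimately show ?thesis
    by blast
qed

instance ell2 :: second_countable_topology
proof
  let ?B = "(\<lambda>(d, n). ball d (1 / real (Suc n))) ` (ell2_rational \<times> (UNIV :: nat set))"
  have "topological_basis ?B"
  proof (rule topological_basisI)
    fix U :: "ell2 set" and x
    assume "open U" "x \<in> U"
    then obtain e where e: "0 < e" "ball x e \<subseteq> U"
      by (auto simp: open_contains_ball)
    obtain n where n: "1 / real (Suc n) < e / 2"
      using nat_approx_posE[of "e / 2"] e(1) by auto
    obtain d where d: "d \<in> ell2_rational" "dist d x < 1 / real (Suc n)"
      using ell2_rational_dense[of "1 / real (Suc n)" x] by auto
    have "ball d (1 / real (Suc n)) \<subseteq> ball x e"
    proof
      fix y
      assume "y \<in> ball d (1 / real (Suc n))"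
      then show "y \<in> ball x e"
        using dist_triangle[of x y d] d(2) n by (simp add: dist_commute)
    qed
    moreover have "ball d (1 / real (Suc n)) \<in> ?B"
      using d(1) by auto
    ultimately show "\<exists>B'\<in>?B. x \<in> B' \<and> B' \<subseteq> U"
      using d(2) e(2) by (meson mem_ball order_trans)
  qed auto
  moreover have "countable ?B"
    by (intro countable_image countable_SIGMA countable_ell2_rational) auto
  ultimately show "\<exists>B :: ell2 set set. countable B \<and> open = generate_topology B"
    using topological_basis_imp_subbasis by blast
qed

lemma separable_ell2: "separable_space (euclidean :: ell2 topology)"
proof -
  have "closure ell2_rational = UNIV"
    using ell2_rational_dense by (auto simp: closure_approachable)
  then show ?thesis
    unfolding separable_space_def using countable_ell2_rational by auto
qed

lemma infinite_dimensional_ell2: "\<not> (\<exists>B :: ell2 set. finite B \<and> span B = UNIV)"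
proof
  assume "\<exists>B :: ell2 set. finite B \<and> span B = UNIV"
  then obtain B :: "ell2 set" where B: "finite B" "span B = UNIV"
    by blast
  have inj: "inj ell2_unit"
    by (rule injI) (metis ell2_unit.rep_eq zero_neq_one)
  have "independent (range ell2_unit)"
  proof (rule pairwise_orthogonal_independent)
    show "pairwise orthogonal (range ell2_unit)"
      by (auto simp: pairwise_def orthogonal_def inner_ell2_unit ell2_unit.rep_eq)
    show "0 \<notin> range ell2_unit"
      by (metis imageE norm_ell2_unit norm_zero zero_neq_one)
  qed
  then have "finite (range ell2_unit)"
    using independent_span_bound[OF B(1)] B(2) by auto
  then show False
    using inj finite_imageD infinite_UNIV_nat by blast
qed

lemma second_countable_imp_tau_additive:
  fixes \<mu> :: "'a::second_countable_topology measure"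
  assumes sets: "sets \<mu> = sets borel"
  shows "tau_additive \<mu>"
  unfolding tau_additive_def
proof (intro allI impI antisym)
  fix \<U> :: "'a set set"
  assume op: "\<forall>U\<in>\<U>. open U"
  let ?S = "SUP \<F>\<in>{\<F>. finite \<F> \<and> \<F> \<subseteq> \<U>}. emeasure \<mu> (\<Union>\<F>)"
  have meas: "\<Union>\<F> \<in> sets \<mu>" if "\<F> \<subseteq> \<U>" for \<F>
    unfolding sets using op that by (auto intro!: borel_open)
  show "?S \<le> emeasure \<mu> (\<Union>\<U>)"
    by (intro SUP_least emeasure_mono meas) auto
  obtain \<C> where \<C>: "\<C> \<subseteq> \<U>" "countable \<C>" "\<Union>\<C> = \<Union>\<U>"
    using Lindelof[of \<U>] op by metis
  show "emeasure \<mu> (\<Union>\<U>) \<le> ?S"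
  proof (cases "\<C> = {}")
    case False
    let ?F = "\<lambda>n. from_nat_into \<C> ` {..n :: nat}"
    have F: "?F n \<subseteq> \<U>" for n
      using from_nat_into[OF False] \<C>(1) by auto
    have "(SUP n. emeasure \<mu> (\<Union>(?F n))) = emeasure \<mu> (\<Union>n. \<Union>(?F n))"
    proof (rule SUP_emeasure_incseq)
      show "incseq (\<lambda>n. \<Union>(?F n))"
        by (intro monoI Union_mono image_mono) auto
    qed (use meas F in auto)
    also have "(\<Union>n. \<Union>(?F n)) = \<Union>(range (from_nat_into \<C>))"
      by auto
    also have "\<dots> = \<Union>\<U>"
      using False \<C> by (simp add: range_from_nat_into)
    finally have "emeasure \<mu> (\<Union>\<U>) = (SUP n. emeasure \<mu> (\<Union>(?F n)))"
      by simp
    also have "\<dots> \<le> ?S"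
      by (intro SUP_mono) (use F in blast)
    finally show ?thesis .
  next
    case True
    then have "\<Union>\<U> = {}"
      using \<C>(3) by simp
    then show ?thesis
      by (simp only: emeasure_empty zero_le)
  qed
qed

section \<open>Blocks of coordinates and the escaping map\<close>

definition block_dim :: "nat \<Rightarrow> nat"
  where "block_dim k = 10 ^ 8 * 2 ^ k"

definition block_start :: "nat \<Rightarrow> nat"
  where "block_start k = (\<Sum>j<k. block_dim j)"

definition block :: "nat \<Rightarrow> nat set"
  where "block k = {block_start k..<block_start (Suc k)}"

definition block_index :: "nat \<Rightarrow> nat"
  where "block_index i = (LEAST k. i < block_start (Suc k))"

definition coord_var :: "nat \<Rightarrow> real"
  where "coord_var i = (1 / 16) ^ block_index i / real (block_dim (block_index i))"

definition typical :: "(nat \<Rightarrow> real) set"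
  where "typical = {\<omega>. \<forall>k. \<bar>(\<Sum>i\<in>block k. (\<omega> i)\<^sup>2) - real (block_dim k)\<bar> \<le> real (block_dim k) / 4000}"

lemma block_dim_pos [simp]: "0 < block_dim k"
  by (simp add: block_dim_def)

lemma block_start_0 [simp]: "block_start 0 = 0"
  by (simp add: block_start_def)

lemma block_start_Suc: "block_start (Suc k) = block_start k + block_dim k"
  by (simp add: block_start_def)

lemma strict_mono_block_start: "strict_mono block_start"
  by (simp add: strict_mono_Suc_iff block_start_Suc)

lemma block_start_mono: "j \<le> k \<Longrightarrow> block_start j \<le> block_start k"
  using strict_mono_block_start by (simp add: strict_mono_less_eq)

lemma finite_block [simp]: "finite (block k)"
  by (simp add: block_def)

lemma card_block [simp]: "card (block k) = block_dim k"
  by (simp add: block_def block_start_Suc)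

lemma block_subset_lessThan: "j < k \<Longrightarrow> block j \<subseteq> {..<block_start k}"
  using block_start_mono[of "Suc j" k] by (auto simp: block_def)

lemma block_disjoint: "i \<in> block j \<Longrightarrow> i \<in> block k \<Longrightarrow> j = k"
  using block_start_mono[of "Suc j" k] block_start_mono[of "Suc k" j]
  by (cases j k rule: linorder_cases) (auto simp: block_def)

lemma block_index_eq:
  assumes "i \<in> block k"
  shows "block_index i = k"
  unfolding block_index_def
proof (rule Least_equality)
  show "i < block_start (Suc k)"
    using assms by (simp add: block_def)
  show "k \<le> j" if "i < block_start (Suc j)" for j
    using assms that block_start_mono[of "Suc j" k] by (fastforce simp: block_def not_less_eq_eq)
qed

lemma coord_var_block: "i \<in> block k \<Longrightarrow> coord_var i = (1 / 16) ^ k / real (block_dim k)"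
  by (simp add: coord_var_def block_index_eq)

lemma coord_var_pos [simp]: "0 < coord_var i"
  by (simp add: coord_var_def)

lemma coord_var_nonneg [simp]: "0 \<le> coord_var i"
  by (simp add: less_imp_le)

lemma sum_blocks:
  fixes f :: "nat \<Rightarrow> 'a::comm_monoid_add"
  shows "(\<Sum>i<block_start k. f i) = (\<Sum>j<k. \<Sum>i\<in>block j. f i)"
proof (induction k)
  case (Suc k)
  have "(\<Sum>i<block_start (Suc k). f i) = (\<Sum>i<block_start k. f i) + (\<Sum>i\<in>block k. f i)"
    using block_start_mono[of k "Suc k"]
    by (simp add: block_def lessThan_atLeast0 sum.atLeastLessThan_concat)
  with Suc show ?case
    by simp
qed simp

lemma geometric_blocks:
  fixes f :: "nat \<Rightarrow> real"
  assumes nonneg: "\<And>i. 0 \<le> f i" and c: "0 \<le> c"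
    and blocks: "\<And>j. k \<le> j \<Longrightarrow> (\<Sum>i\<in>block j. f i) \<le> c * (1 / 16) ^ j"
  shows "summable f" and "(\<Sum>i. f (i + block_start k)) \<le> 16 / 15 * c * (1 / 16) ^ k"
proof -
  have bd: "(\<Sum>i<n. f (i + block_start k)) \<le> 16 / 15 * c * (1 / 16) ^ k" for n
  proof -
    have n: "n \<le> block_start (k + n)"
      using strict_mono_imp_increasing[OF strict_mono_block_start, of "k + n"] by simp
    have "(\<Sum>i<n. f (i + block_start k)) \<le> (\<Sum>i = block_start k..<block_start k + n. f i)"
      using sum.shift_bounds_nat_ivl[of f 0 "block_start k" n]
      by (simp add: lessThan_atLeast0 add.commute[of n])
    also have "\<dots> \<le> (\<Sum>i = block_start k..<block_start (k + n). f i)"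
    proof (rule sum_mono2)
      have "block_start k + n \<le> block_start (k + n)"
      proof (induction n)
        case (Suc n)
        then show ?case
          using block_dim_pos[of "k + n"] by (simp add: block_start_Suc del: block_dim_pos)
      qed simp
      then show "{block_start k..<block_start k + n} \<subseteq> {block_start k..<block_start (k + n)}"
        by simp
    qed (use nonneg in auto)
    also have "\<dots> = (\<Sum>j<n. \<Sum>i\<in>block (k + j). f i)"
    proof (induction n)
      case (Suc n)
      have "(\<Sum>i = block_start k..<block_start (k + Suc n). f i)
          = (\<Sum>i = block_start k..<block_start (k + n). f i) + (\<Sum>i\<in>block (k + n). f i)"
        unfolding block_def using block_start_mono[of k "k + n"] block_start_mono[of "k + n" "Suc (k + n)"]
        by (simp add: sum.atLeastLessThan_concat)
      with Suc show ?case
        by simp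
    qed simp
    also have "\<dots> \<le> (\<Sum>j<n. c * (1 / 16) ^ (k + j))"
      by (intro sum_mono blocks) simp
    also have "\<dots> = c * (1 / 16) ^ k * (\<Sum>j<n. (1 / 16) ^ j)"
      by (simp add: power_add sum_distrib_left mult.assoc)
    also have "\<dots> \<le> c * (1 / 16) ^ k * (16 / 15)"
    proof (rule mult_left_mono)
      have "(\<Sum>j<n. (1 / 16) ^ j) \<le> (\<Sum>j. (1 / 16 :: real) ^ j)"
        by (intro sum_le_suminf summable_geometric) auto
      then show "(\<Sum>j<n. (1 / 16) ^ j) \<le> (16 / 15 :: real)"
        by (simp add: suminf_geometric)
    qed (use c in simp)
    finally show ?thesis
      by (simp add: mult_ac)
  qed
  have sm: "summable (\<lambda>i. f (i + block_start k))"
    by (rule summableI_nonneg_bounded[OF nonneg bd])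
  then show "summable f"
    by (simp add: summable_iff_shift)
  show "(\<Sum>i. f (i + block_start k)) \<le> 16 / 15 * c * (1 / 16) ^ k"
    using bd by (intro suminf_le_const sm)
qed

lemma summable_coord_var: "summable coord_var"
proof (rule geometric_blocks(1)[where k = 0 and c = 1])
  show "(\<Sum>i\<in>block j. coord_var i) \<le> 1 * (1 / 16) ^ j" for j
    by (simp add: coord_var_block)
qed simp_all

lemma typicalD:
  assumes "\<omega> \<in> typical"
  shows "(\<Sum>i\<in>block k. (\<omega> i)\<^sup>2) \<le> 4001 / 4000 * real (block_dim k)"
    and "3999 / 4000 * real (block_dim k) \<le> (\<Sum>i\<in>block k. (\<omega> i)\<^sup>2)"
proof -
  have "\<bar>(\<Sum>i\<in>block k. (\<omega> i)\<^sup>2) - real (block_dim k)\<bar> \<le> real (block_dim k) / 4000"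
    using assms by (simp add: typical_def)
  then show "(\<Sum>i\<in>block k. (\<omega> i)\<^sup>2) \<le> 4001 / 4000 * real (block_dim k)"
    and "3999 / 4000 * real (block_dim k) \<le> (\<Sum>i\<in>block k. (\<omega> i)\<^sup>2)"
    by linarith+
qed

lemma sum_square_combination:
  fixes x y :: "'a \<Rightarrow> real"
  shows "(\<Sum>i\<in>I. (a * y i + b * x i)\<^sup>2) =
    a * (a + b) * (\<Sum>i\<in>I. (y i)\<^sup>2) + b * (a + b) * (\<Sum>i\<in>I. (x i)\<^sup>2) - a * b * (\<Sum>i\<in>I. (y i - x i)\<^sup>2)"
  unfolding sum_distrib_left sum_subtractf[symmetric] sum.distrib[symmetric]
  by (rule sum.cong) (simp_all add: power2_eq_square algebra_simps)

text \<open>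
  With \<open>t = 1/1000\<close> and \<open>t' = 1/20000\<close>, the map sends \<open>\<xi> + z\<close> to \<open>\<xi> + (1 - t/2 - t') z - t \<xi>\<close> in the block \<open>k\<close>
  and to \<open>\<xi> + (1 - t') z\<close> in the other blocks up to \<open>k + 1\<close>. The part \<open>t/2\<close> of the contraction
  compensates the growth of \<open>z\<close> in the block \<open>k\<close> to first order, and \<open>t'\<close> absorbs the second order terms.
\<close>

definition escape_scale :: "nat \<Rightarrow> nat \<Rightarrow> real"
  where "escape_scale k i = (if block_start (k + 2) \<le> i then 1
    else if i \<in> block k then 19989 / 20000 else 19999 / 20000)"

definition escape_shift :: "nat \<Rightarrow> nat \<Rightarrow> real"
  where "escape_shift k i = (if block_start (k + 2) \<le> i then 0
    else if i \<in> block k then - 9 / 20000 else 1 / 20000)"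

definition escape :: "nat \<Rightarrow> (nat \<Rightarrow> real) \<Rightarrow> (nat \<Rightarrow> real) \<Rightarrow> nat \<Rightarrow> real"
  where "escape k \<xi> \<omega> i = escape_scale k i * \<omega> i + escape_shift k i * \<xi> i"

lemma escape_eq:
  "i \<in> block k \<Longrightarrow> escape k \<xi> \<omega> i = 19989 / 20000 * \<omega> i + (- 9 / 20000) * \<xi> i"
  "i \<in> block j \<Longrightarrow> j < k + 2 \<Longrightarrow> j \<noteq> k \<Longrightarrow> escape k \<xi> \<omega> i = 19999 / 20000 * \<omega> i + 1 / 20000 * \<xi> i"
  "block_start (k + 2) \<le> i \<Longrightarrow> escape k \<xi> \<omega> i = \<omega> i"
  using block_subset_lessThan[of k "k + 2"] block_subset_lessThan[of j "k + 2"] block_disjoint[of i j k]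
  by (auto simp: escape_def escape_scale_def escape_shift_def)

lemma block_dist_le:
  assumes "summable (\<lambda>i. coord_var i * (\<omega> i - \<xi> i)\<^sup>2)"
    and "(\<Sum>i. coord_var i * (\<omega> i - \<xi> i)\<^sup>2) \<le> R" and "R \<le> (1 / 16) ^ k"
  shows "(\<Sum>i\<in>block k. (\<omega> i - \<xi> i)\<^sup>2) \<le> real (block_dim k)"
proof -
  have "(1 / 16) ^ k / real (block_dim k) * (\<Sum>i\<in>block k. (\<omega> i - \<xi> i)\<^sup>2)
      = (\<Sum>i\<in>block k. coord_var i * (\<omega> i - \<xi> i)\<^sup>2)"
    unfolding sum_distrib_left by (rule sum.cong) (simp_all add: coord_var_block)
  also have "\<dots> \<le> (\<Sum>i. coord_var i * (\<omega> i - \<xi> i)\<^sup>2)"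
    by (intro sum_le_suminf assms) auto
  also have "\<dots> \<le> (1 / 16) ^ k"
    using assms by simp
  finally show ?thesis
    by (simp add: field_simps)
qed

lemma escape_not_typical:
  assumes "\<xi> \<in> typical" "\<omega> \<in> typical"
    and Z: "(\<Sum>i\<in>block k. (\<omega> i - \<xi> i)\<^sup>2) \<le> real (block_dim k)"
  shows "escape k \<xi> \<omega> \<notin> typical"
proof
  assume "escape k \<xi> \<omega> \<in> typical"
  note typicalD(2)[OF this, of k]
  also have "(\<Sum>i\<in>block k. (escape k \<xi> \<omega> i)\<^sup>2)
      = (\<Sum>i\<in>block k. (19989 / 20000 * \<omega> i + (- 9 / 20000) * \<xi> i)\<^sup>2)"
    by (intro sum.cong) (simp_all add: escape_eq)
  finally show False
    unfolding sum_square_combination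
    using typicalD[OF assms(1), of k] typicalD[OF assms(2), of k] Z block_dim_pos[of k]
    by (simp add: field_simps)
qed

lemma escape_near:
  assumes "\<xi> \<in> typical" "\<omega> \<in> typical"
    and sm: "summable (\<lambda>i. coord_var i * (\<omega> i - \<xi> i)\<^sup>2)"
    and le: "(\<Sum>i. coord_var i * (\<omega> i - \<xi> i)\<^sup>2) \<le> R"
    and R: "(1 / 16) ^ (k + 1) \<le> R" "R \<le> (1 / 16) ^ k"
  shows "(\<Sum>i. coord_var i * (escape k \<xi> \<omega> i - \<xi> i)\<^sup>2) \<le> R"
proof -
  let ?u = "\<lambda>i. coord_var i * (\<omega> i - \<xi> i)\<^sup>2" and ?v = "\<lambda>i. coord_var i * (escape k \<xi> \<omega> i - \<xi> i)\<^sup>2"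
  let ?M = "block_start (k + 2)" and ?s = "(1 / 16 :: real) ^ k"
  let ?a = "(19999 / 20000)\<^sup>2 :: real"
  have tail_eq: "?v (i + ?M) = ?u (i + ?M)" for i
    by (simp add: escape_eq)
  have sm': "summable ?v"
    using sm unfolding summable_iff_shift[of ?v ?M, symmetric] summable_iff_shift[of ?u ?M, symmetric] tail_eq .
  define H where "H = (\<Sum>i<?M. ?u i)"
  define W where "W = (\<Sum>i. ?u (i + ?M))"
  have HW: "H + W \<le> R"
    using le suminf_split_initial_segment[OF sm, of ?M] by (simp add: H_def W_def)
  have H: "0 \<le> H"
    unfolding H_def by (intro sum_nonneg mult_nonneg_nonneg) (auto intro: less_imp_le)
  have "W \<le> 16 / 15 * (4 * (4001 / 4000)) * (1 / 16) ^ (k + 2)"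
    unfolding W_def
  proof (rule geometric_blocks(2))
    show "(0 :: real) \<le> 4 * (4001 / 4000)"
      by simp
    show "0 \<le> ?u i" for i
      by auto
    show "(\<Sum>i\<in>block j. ?u i) \<le> 4 * (4001 / 4000) * (1 / 16) ^ j" for j
    proof -
      have "(\<Sum>i\<in>block j. (\<omega> i - \<xi> i)\<^sup>2) \<le> (\<Sum>i\<in>block j. 2 * (\<omega> i)\<^sup>2 + 2 * (\<xi> i)\<^sup>2)"
        by (intro sum_mono) (smt (verit) power2_diff sum_squares_bound zero_le_power2 power2_sum)
      also have "\<dots> \<le> 4 * (4001 / 4000) * real (block_dim j)"
        using typicalD[OF assms(1), of j] typicalD[OF assms(2), of j]
        by (simp add: sum.distrib flip: sum_distrib_left)
      finally have "(1 / 16) ^ j / real (block_dim j) * (\<Sum>i\<in>block j. (\<omega> i - \<xi> i)\<^sup>2)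
          \<le> (1 / 16) ^ j / real (block_dim j) * (4 * (4001 / 4000) * real (block_dim j))"
        by (rule mult_left_mono) simp
      also have "(1 / 16) ^ j / real (block_dim j) * (\<Sum>i\<in>block j. (\<omega> i - \<xi> i)\<^sup>2) = (\<Sum>i\<in>block j. ?u i)"
        unfolding sum_distrib_left by (rule sum.cong) (simp_all add: coord_var_block)
      finally show ?thesis
        using block_dim_pos[of j] by simp
    qed
  qed
  then have W: "W \<le> 67 / 4000 * ?s"
    by (simp add: power_add) (use zero_le_power[of "1/16::real" k] in linarith)
  have other: "(\<Sum>i\<in>block j. ?v i) = ?a * (\<Sum>i\<in>block j. ?u i)" if "j < k + 2" "j \<noteq> k" for j
    unfolding sum_distrib_left
  proof (rule sum.cong)
    fix i assume i: "i \<in> block j"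
    have "escape k \<xi> \<omega> i - \<xi> i = 19999 / 20000 * (\<omega> i - \<xi> i)"
      by (simp add: escape_eq(2)[OF i that] field_simps)
    then show "?v i = ?a * ?u i"
      by (simp only: power_mult_distrib mult.left_commute)
  qed simp
  have own: "(\<Sum>i\<in>block k. ?v i) \<le> ?a * (\<Sum>i\<in>block k. ?u i) + 1 / 500000 * ?s"
  proof -
    have "(\<Sum>i\<in>block k. ?v i) = ?s / real (block_dim k) * (\<Sum>i\<in>block k. (19989 / 20000 * \<omega> i + (- 20009 / 20000) * \<xi> i)\<^sup>2)"
      unfolding sum_distrib_left
      by (rule sum.cong) (simp_all add: coord_var_block escape_eq algebra_simps)
    also have "\<dots> \<le> ?s / real (block_dim k) * (?a * (\<Sum>i\<in>block k. (\<omega> i - \<xi> i)\<^sup>2) + 1 / 500000 * real (block_dim k))"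
    proof (rule mult_left_mono)
      have "0 \<le> (\<Sum>i\<in>block k. (\<omega> i - \<xi> i)\<^sup>2)"
        by (simp add: sum_nonneg)
      then show "(\<Sum>i\<in>block k. (19989 / 20000 * \<omega> i + (- 20009 / 20000) * \<xi> i)\<^sup>2)
          \<le> ?a * (\<Sum>i\<in>block k. (\<omega> i - \<xi> i)\<^sup>2) + 1 / 500000 * real (block_dim k)"
        unfolding sum_square_combination
        using typicalD[OF assms(1), of k] typicalD[OF assms(2), of k] block_dim_pos[of k]
        by (simp add: power2_eq_square)
    qed simp
    also have "\<dots> = ?a * (\<Sum>i\<in>block k. ?s / real (block_dim k) * (\<omega> i - \<xi> i)\<^sup>2) + 1 / 500000 * ?s"
      using block_dim_pos[of k] unfolding sum_distrib_left[symmetric] by (simp add: field_simps)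
    also have "(\<Sum>i\<in>block k. ?s / real (block_dim k) * (\<omega> i - \<xi> i)\<^sup>2) = (\<Sum>i\<in>block k. ?u i)"
      by (rule sum.cong) (simp_all add: coord_var_block)
    finally show ?thesis .
  qed
  have "(\<Sum>i<?M. ?v i) = (\<Sum>j<k + 2. \<Sum>i\<in>block j. ?v i)"
    by (rule sum_blocks)
  also have "\<dots> \<le> (\<Sum>j<k + 2. ?a * (\<Sum>i\<in>block j. ?u i) + (if j = k then 1 / 500000 * ?s else 0))"
    by (intro sum_mono) (use own other in auto)
  also have "\<dots> = ?a * H + 1 / 500000 * ?s"
    unfolding H_def sum_blocks by (simp add: sum.distrib flip: sum_distrib_left)
  finally have "(\<Sum>i. ?v i) \<le> ?a * H + 1 / 500000 * ?s + W"
    using suminf_split_initial_segment[OF sm', of ?M] unfolding W_def tail_eq by linarith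
  also have "\<dots> \<le> R"
  proof (cases "1 / 500000 * ?s \<le> (1 - ?a) * H")
    case True
    then show ?thesis
      using HW by (simp add: algebra_simps)
  next
    case False
    then have "H \<le> 1 / 24 * ?s" and "?a * H \<le> H"
      using H by (simp_all add: power2_eq_square mult_left_le_one_le)
    moreover have "1 / 16 * ?s \<le> R"
      using R(1) by simp
    moreover have "0 \<le> ?s"
      by simp
    ultimately show ?thesis
      using W by linarith
  qed
  finally show ?thesis .
qed

definition escape_density :: "nat \<Rightarrow> (nat \<Rightarrow> real) \<Rightarrow> (nat \<Rightarrow> real) \<Rightarrow> nat \<Rightarrow> real"
  where "escape_density k \<xi> \<omega> i = escape_scale k i * exp (- ((escape k \<xi> \<omega> i)\<^sup>2 - (\<omega> i)\<^sup>2) / 2)"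

lemma escape_density_ge_1:
  assumes "\<xi> \<in> typical" "\<omega> \<in> typical"
    and Z: "(\<Sum>i\<in>block k. (\<omega> i - \<xi> i)\<^sup>2) \<le> real (block_dim k)"
  shows "1 \<le> (\<Prod>i<block_start (k + 2). escape_density k \<xi> \<omega> i)"
proof -
  let ?N = "\<lambda>j. real (block_dim j)"
  define h where "h i = ln (escape_scale k i) - ((escape k \<xi> \<omega> i)\<^sup>2 - (\<omega> i)\<^sup>2) / 2" for i
  have "escape_density k \<xi> \<omega> i = exp (h i)" for i
  proof -
    have "0 < escape_scale k i"
      by (simp add: escape_scale_def)
    then show ?thesis
      by (simp only: escape_density_def h_def diff_conv_add_uminus exp_add exp_ln minus_divide_left)
  qed
  then have prod_eq: "(\<Prod>i<block_start (k + 2). escape_density k \<xi> \<omega> i) = exp (\<Sum>i<block_start (k + 2). h i)"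
    by (simp add: exp_sum)
  have ln_k: "- 556 / 10 ^ 6 \<le> ln (19989 / 20000 :: real)"
    using ln_one_minus_pos_lower_bound[of "11 / 20000"] by (simp add: power2_eq_square)
  have ln_other: "- 50005 / 10 ^ 9 - 1 / 10 ^ 9 \<le> ln (19999 / 20000 :: real)"
    using ln_one_minus_pos_lower_bound[of "1 / 20000"] by (simp add: power2_eq_square)
  have other: "- 501 / 10 ^ 7 * ?N j \<le> (\<Sum>i\<in>block j. h i)" if j: "j < k + 2" "j \<noteq> k" for j
  proof -
    have "(\<Sum>i\<in>block j. h i) = (\<Sum>i\<in>block j. ln (19999 / 20000) -
        ((19999 / 20000 * \<omega> i + 1 / 20000 * \<xi> i)\<^sup>2 - (\<omega> i)\<^sup>2) / 2)"
      using j block_disjoint block_subset_lessThan[OF j(1)]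
      by (intro sum.cong refl) (auto simp: h_def escape_eq(2)[OF _ j] escape_scale_def)
    also have "\<dots> = ?N j * ln (19999 / 20000) -
        ((\<Sum>i\<in>block j. (19999 / 20000 * \<omega> i + 1 / 20000 * \<xi> i)\<^sup>2) - (\<Sum>i\<in>block j. (\<omega> i)\<^sup>2)) / 2"
      by (simp add: sum_subtractf flip: sum_divide_distrib)
    finally have eq: "(\<Sum>i\<in>block j. h i) = \<dots>" .
    have "0 \<le> (\<Sum>i\<in>block j. (\<omega> i - \<xi> i)\<^sup>2)"
      by (simp add: sum_nonneg)
    moreover have "?N j * (- 50005 / 10 ^ 9 - 1 / 10 ^ 9) \<le> ?N j * ln (19999 / 20000)"
      by (rule mult_left_mono[OF ln_other]) simp
    ultimately show ?thesis
      unfolding eq sum_square_combination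
      using typicalD[OF assms(1), of j] typicalD[OF assms(2), of j] block_dim_pos[of j]
      by (simp add: field_simps)
  qed
  have own: "2 / 10 ^ 4 * ?N k \<le> (\<Sum>i\<in>block k. h i)"
  proof -
    have "(\<Sum>i\<in>block k. h i) = (\<Sum>i\<in>block k. ln (19989 / 20000) -
        ((19989 / 20000 * \<omega> i + (- 9 / 20000) * \<xi> i)\<^sup>2 - (\<omega> i)\<^sup>2) / 2)"
      using block_subset_lessThan[of k "k + 2"]
      by (intro sum.cong refl) (auto simp: h_def escape_eq(1) escape_scale_def)
    also have "\<dots> = ?N k * ln (19989 / 20000) -
        ((\<Sum>i\<in>block k. (19989 / 20000 * \<omega> i + (- 9 / 20000) * \<xi> i)\<^sup>2) - (\<Sum>i\<in>block k. (\<omega> i)\<^sup>2)) / 2"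
      by (simp add: sum_subtractf flip: sum_divide_distrib)
    finally have eq: "(\<Sum>i\<in>block k. h i) = \<dots>" .
    have "?N k * (- 556 / 10 ^ 6) \<le> ?N k * ln (19989 / 20000)"
      by (rule mult_left_mono[OF ln_k]) simp
    then show ?thesis
      unfolding eq sum_square_combination
      using typicalD[OF assms(1), of k] typicalD[OF assms(2), of k] Z block_dim_pos[of k]
      by (simp add: field_simps)
  qed
  have "(\<Sum>j<k. ?N j) \<le> ?N k"
    by (induction k) (simp_all add: block_dim_def)
  then have "(\<Sum>j<k + 2. ?N j) \<le> 4 * ?N k"
    by (simp add: block_dim_def)
  then have "0 \<le> (\<Sum>j<k + 2. - 501 / 10 ^ 7 * ?N j + (if j = k then 2501 / 10 ^ 7 * ?N k else 0))"
    unfolding sum.distrib sum_distrib_left[symmetric] by simp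
  also have "\<dots> \<le> (\<Sum>j<k + 2. \<Sum>i\<in>block j. h i)"
    by (intro sum_mono) (use own other in auto)
  finally show ?thesis
    unfolding prod_eq sum_blocks by simp
qed

section \<open>Products of standard normal distributions\<close>

definition gauss_prod :: "(nat \<Rightarrow> real) measure"
  where "gauss_prod = (\<Pi>\<^sub>M i\<in>UNIV. std_normal_distribution)"

interpretation gauss: product_prob_space "\<lambda>_ :: nat. std_normal_distribution" UNIV
  rewrites "Pi\<^sub>M UNIV (\<lambda>_ :: nat. std_normal_distribution) = gauss_prod"
proof -
  show "product_prob_space (\<lambda>_ :: nat. std_normal_distribution)"
    by (intro product_prob_spaceI prob_space_normal_density) simp
qed (simp add: gauss_prod_def)

lemma sets_gauss_prod [measurable_cong, simp]: "sets gauss_prod = sets (\<Pi>\<^sub>M i\<in>UNIV. borel)"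
  unfolding gauss_prod_def by (intro sets_PiM_cong) simp_all

lemma space_gauss_prod [simp]: "space gauss_prod = UNIV"
  by (simp add: gauss_prod_def space_PiM)

lemma measurable_gauss_coordinate [measurable]: "(\<lambda>\<omega>. \<omega> i) \<in> borel_measurable gauss_prod"
  by measurable

lemma distr_gauss_coordinate: "distr gauss_prod borel (\<lambda>\<omega>. \<omega> i) = std_normal_distribution"
proof -
  have "distr gauss_prod borel (\<lambda>\<omega>. \<omega> i) = distr gauss_prod std_normal_distribution (\<lambda>\<omega>. \<omega> i)"
    by (intro distr_cong) simp_all
  then show ?thesis
    using gauss.PiM_component[of i] by simp
qed

lemma gauss_indep: "I \<noteq> {} \<Longrightarrow> gauss.indep_vars (\<lambda>_. borel) (\<lambda>i \<omega>. \<omega> i) I"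
proof -
  have "gauss.indep_vars (\<lambda>_. borel) (\<lambda>i \<omega>. \<omega> i) UNIV"
    by (subst gauss.indep_vars_iff_distr_eq_PiM)
       (auto simp: distr_gauss_coordinate distr_id2 restrict_UNIV gauss_prod_def[symmetric])
  then show ?thesis
    by (rule gauss.indep_vars_subset) simp
qed

definition affine_density :: "real \<Rightarrow> real \<Rightarrow> real \<Rightarrow> real"
  where "affine_density c d t = c * exp (- ((c * t + d)\<^sup>2 - t\<^sup>2) / 2)"

lemma affine_density_measurable [measurable]: "affine_density c d \<in> borel_measurable borel"
  unfolding affine_density_def by measurable

lemma affine_density_nonneg: "0 < c \<Longrightarrow> 0 \<le> affine_density c d t"
  by (simp add: affine_density_def)

lemma emeasure_affine_std_normal:
  assumes "0 < c" and [measurable]: "A \<in> sets borel"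
  shows "emeasure std_normal_distribution ((\<lambda>t. (t - d) / c) -` A)
    = (\<integral>\<^sup>+t. ennreal (affine_density c d t * indicator A t) \<partial>std_normal_distribution)"
proof -
  have "emeasure std_normal_distribution ((\<lambda>t. (t - d) / c) -` A)
      = (\<integral>\<^sup>+t. ennreal (std_normal_density t) * indicator A ((t - d) / c) \<partial>lborel)"
    using measurable_sets_borel[of "\<lambda>t. (t - d) / c" borel A]
    by (subst emeasure_density) (auto intro!: nn_integral_cong simp: indicator_def)
  also have "\<dots> = ennreal c * (\<integral>\<^sup>+t. ennreal (std_normal_density (d + c * t)) * indicator A t \<partial>lborel)"
    using assms by (subst nn_integral_real_affine[where c = c and t = d]) auto
  also have "\<dots> = (\<integral>\<^sup>+t. ennreal (std_normal_density t) * ennreal (affine_density c d t * indicator A t) \<partial>lborel)"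
  proof -
    have "ennreal c * (ennreal (std_normal_density (d + c * t)) * indicator A t)
        = ennreal (std_normal_density t) * ennreal (affine_density c d t * indicator A t)" for t
    proof -
      have "c * std_normal_density (d + c * t) = std_normal_density t * affine_density c d t"
        by (simp add: std_normal_density_def affine_density_def field_simps flip: exp_add)
      then show ?thesis
        using assms(1) by (cases "t \<in> A") (simp_all add: affine_density_nonneg flip: ennreal_mult)
    qed
    then show ?thesis
      using assms by (subst nn_integral_cmult[symmetric]) (auto intro!: nn_integral_cong)
  qed
  also have "\<dots> = (\<integral>\<^sup>+t. ennreal (affine_density c d t * indicator A t) \<partial>std_normal_distribution)"
    by (subst nn_integral_density) auto
  finally show ?thesis .
qed

lemma cylinder_gauss:
  "prod_emb UNIV (\<lambda>_. std_normal_distribution) J (Pi\<^sub>E J A) = {\<omega>. \<forall>i\<in>J. \<omega> i \<in> A i}"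
  by (auto simp: prod_emb_def PiE_iff)

lemma emeasure_cylinder_gauss:
  assumes "finite J" "\<And>i. i \<in> J \<Longrightarrow> A i \<in> sets borel"
  shows "emeasure gauss_prod {\<omega>. \<forall>i\<in>J. \<omega> i \<in> A i} = (\<Prod>i\<in>J. emeasure std_normal_distribution (A i))"
  using gauss.emeasure_PiM_emb[of J A] assms unfolding cylinder_gauss by simp

lemma distr_gauss_affine:
  fixes c d :: "nat \<Rightarrow> real"
  assumes pos: "\<And>i. 0 < c i"
    and rest: "\<And>i. n \<le> i \<Longrightarrow> c i = 1" "\<And>i. n \<le> i \<Longrightarrow> d i = 0"
  shows "distr gauss_prod gauss_prod (\<lambda>\<omega> i. (\<omega> i - d i) / c i)
    = density gauss_prod (\<lambda>\<omega>. ennreal (\<Prod>i<n. affine_density (c i) (d i) (\<omega> i)))"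
    (is "?D = ?E")
proof (rule measure_eqI_PiM_infinite[where I = UNIV and M = "\<lambda>_. std_normal_distribution"])
  have S: "(\<lambda>\<omega> i. (\<omega> i - d i) / c i) \<in> gauss_prod \<rightarrow>\<^sub>M gauss_prod"
    unfolding measurable_cong_sets[OF refl sets_gauss_prod]
    by (rule measurable_PiM_single') auto
  show "finite_measure ?D"
    using gauss.prob_space_distr[OF S] by (rule prob_space.finite_measure)
  fix A :: "nat \<Rightarrow> real set" and J
  assume J: "finite J" and "\<And>i. i \<in> J \<Longrightarrow> A i \<in> sets std_normal_distribution"
  then have A: "A i \<in> sets borel" if "i \<in> J" for i
    using that by simp
  define K where "K = J \<union> {..<n}"
  define B where "B i = (if i \<in> J then A i else UNIV)" for i
  have K: "finite K"
    using J by (simp add: K_def)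
  have B [measurable]: "B i \<in> sets borel" for i
    using A by (simp add: B_def)
  have cyl: "{\<omega>. \<forall>i\<in>J. \<omega> i \<in> A i} = {\<omega>. \<forall>i\<in>K. \<omega> i \<in> B i}"
    by (auto simp: K_def B_def)
  have Bc: "(\<lambda>t. (t - d i) / c i) -` B i \<in> sets borel" for i
    using measurable_sets_borel[of "\<lambda>t. (t - d i) / c i" borel "B i"] by simp
  have meas: "{\<omega>. \<forall>i\<in>K. \<omega> i \<in> B i} \<in> sets gauss_prod"
  proof -
    have "{\<omega> \<in> space gauss_prod. \<forall>i\<in>K. \<omega> i \<in> B i} \<in> sets gauss_prod"
      using K by measurable
    then show ?thesis
      by simp
  qed
  have "emeasure ?D {\<omega>. \<forall>i\<in>K. \<omega> i \<in> B i}
      = emeasure gauss_prod {\<omega>. \<forall>i\<in>K. \<omega> i \<in> (\<lambda>t. (t - d i) / c i) -` B i}"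
    using meas by (subst emeasure_distr[OF S]) (auto simp: vimage_def)
  also have "\<dots> = (\<Prod>i\<in>K. emeasure std_normal_distribution ((\<lambda>t. (t - d i) / c i) -` B i))"
    using K Bc by (intro emeasure_cylinder_gauss)
  also have "\<dots> = (\<Prod>i\<in>K. \<integral>\<^sup>+t. ennreal (affine_density (c i) (d i) t * indicator (B i) t) \<partial>std_normal_distribution)"
    by (intro prod.cong emeasure_affine_std_normal pos B refl)
  also have "\<dots> = (\<Prod>i\<in>K. \<integral>\<^sup>+\<omega>. ennreal (affine_density (c i) (d i) (\<omega> i) * indicator (B i) (\<omega> i)) \<partial>gauss_prod)"
    by (intro prod.cong refl, subst distr_gauss_coordinate[symmetric], subst nn_integral_distr) auto
  also have "\<dots> = (\<integral>\<^sup>+\<omega>. (\<Prod>i\<in>K. ennreal (affine_density (c i) (d i) (\<omega> i) * indicator (B i) (\<omega> i))) \<partial>gauss_prod)"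
  proof (cases "K = {}")
    case False
    show ?thesis
      by (intro gauss.indep_vars_nn_integral[symmetric] K gauss.indep_vars_compose2[OF gauss_indep[OF False]])
         auto
  qed (simp add: gauss.emeasure_space_1[simplified])
  also have "\<dots> = (\<integral>\<^sup>+\<omega>. ennreal (\<Prod>i<n. affine_density (c i) (d i) (\<omega> i)) * indicator {\<omega>. \<forall>i\<in>K. \<omega> i \<in> B i} \<omega> \<partial>gauss_prod)"
  proof (rule nn_integral_cong)
    fix \<omega> :: "nat \<Rightarrow> real"
    have "(\<Prod>i\<in>K. affine_density (c i) (d i) (\<omega> i)) = (\<Prod>i<n. affine_density (c i) (d i) (\<omega> i))"
      using K by (intro prod.mono_neutral_right) (auto simp: K_def rest affine_density_def)
    moreover have "(\<Prod>i\<in>K. indicator (B i) (\<omega> i) :: real) = indicator {\<omega>. \<forall>i\<in>K. \<omega> i \<in> B i} \<omega>"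
      using K by (auto simp: indicator_def)
    ultimately have "(\<Prod>i\<in>K. affine_density (c i) (d i) (\<omega> i) * indicator (B i) (\<omega> i))
        = (\<Prod>i<n. affine_density (c i) (d i) (\<omega> i)) * indicator {\<omega>. \<forall>i\<in>K. \<omega> i \<in> B i} \<omega>"
      by (simp add: prod.distrib)
    moreover have "(\<Prod>i\<in>K. ennreal (affine_density (c i) (d i) (\<omega> i) * indicator (B i) (\<omega> i)))
        = ennreal (\<Prod>i\<in>K. affine_density (c i) (d i) (\<omega> i) * indicator (B i) (\<omega> i))"
      by (intro prod_ennreal) (simp add: affine_density_nonneg pos)
    ultimately show "(\<Prod>i\<in>K. ennreal (affine_density (c i) (d i) (\<omega> i) * indicator (B i) (\<omega> i)))
        = ennreal (\<Prod>i<n. affine_density (c i) (d i) (\<omega> i)) * indicator {\<omega>. \<forall>i\<in>K. \<omega> i \<in> B i} \<omega>"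
      by (auto simp: indicator_def)
  qed
  also have "\<dots> = emeasure ?E {\<omega>. \<forall>i\<in>K. \<omega> i \<in> B i}"
    using meas by (subst emeasure_density) auto
  finally show "emeasure ?D (prod_emb UNIV (\<lambda>_. std_normal_distribution) J (Pi\<^sub>E J A))
      = emeasure ?E (prod_emb UNIV (\<lambda>_. std_normal_distribution) J (Pi\<^sub>E J A))"
    unfolding cylinder_gauss cyl .
qed (simp_all add: gauss_prod_def)

lemma gauss_second_moment:
  assumes "finite I"
  shows "integrable gauss_prod (\<lambda>\<omega>. (\<Sum>i\<in>I. (\<omega> i)\<^sup>2 - 1)\<^sup>2)"
    and "(\<integral>\<omega>. (\<Sum>i\<in>I. (\<omega> i)\<^sup>2 - 1)\<^sup>2 \<partial>gauss_prod) = 2 * real (card I)"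
proof -
  let ?X = "\<lambda>i \<omega>. (\<omega> i :: real)\<^sup>2 - 1"
  have int2: "integrable std_normal_distribution (\<lambda>t. (t\<^sup>2 - 1)\<^sup>2)"
    and val2: "(\<integral>t. (t\<^sup>2 - 1)\<^sup>2 \<partial>std_normal_distribution) = 2"
    and int1: "integrable std_normal_distribution (\<lambda>t. t\<^sup>2 - 1)"
    and val1: "(\<integral>t. t\<^sup>2 - 1 \<partial>std_normal_distribution) = 0"
  proof -
    have N: "measure std_normal_distribution UNIV = 1"
      using prob_space.prob_space[OF prob_space_normal_density[of 1 0]] by simp
    note [simp] = integrable_std_normal_distribution_moment
    have eq: "(\<lambda>t :: real. (t\<^sup>2 - 1)\<^sup>2) = (\<lambda>t. t ^ 4 - 2 * t\<^sup>2 + 1)"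
      by (auto simp: power2_eq_square algebra_simps power4_eq_xxxx)
    have m2: "(\<integral>t. t\<^sup>2 \<partial>std_normal_distribution) = 1"
      using std_normal_distribution_even_moments(1)[of 1] by simp
    have m4: "(\<integral>t. t ^ 4 \<partial>std_normal_distribution) = 3"
      using std_normal_distribution_even_moments(1)[of 2] by (simp add: fact_numeral)
    show "integrable std_normal_distribution (\<lambda>t. (t\<^sup>2 - 1)\<^sup>2)"
      "integrable std_normal_distribution (\<lambda>t. t\<^sup>2 - 1)"
      by (simp_all add: eq)
    show "(\<integral>t. (t\<^sup>2 - 1)\<^sup>2 \<partial>std_normal_distribution) = 2"
      "(\<integral>t. t\<^sup>2 - 1 \<partial>std_normal_distribution) = 0"
      using N by (simp_all add: eq m2 m4)
  qed
  have X1: "integrable gauss_prod (?X i)" "(\<integral>\<omega>. ?X i \<omega> \<partial>gauss_prod) = 0"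
    and X2: "integrable gauss_prod (\<lambda>\<omega>. ?X i \<omega> * ?X i \<omega>)" "(\<integral>\<omega>. ?X i \<omega> * ?X i \<omega> \<partial>gauss_prod) = 2" for i
    using integrable_distr_eq[of "\<lambda>\<omega>. \<omega> i" gauss_prod borel "\<lambda>t. t\<^sup>2 - 1"]
      integrable_distr_eq[of "\<lambda>\<omega>. \<omega> i" gauss_prod borel "\<lambda>t. (t\<^sup>2 - 1)\<^sup>2"]
      integral_distr[of "\<lambda>\<omega>. \<omega> i" gauss_prod borel "\<lambda>t. t\<^sup>2 - 1"]
      integral_distr[of "\<lambda>\<omega>. \<omega> i" gauss_prod borel "\<lambda>t. (t\<^sup>2 - 1)\<^sup>2"]
      int1 int2 val1 val2
    by (simp_all add: distr_gauss_coordinate power2_eq_square[of "_ - _"])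
  have indep: "gauss.indep_vars (\<lambda>_. borel) ?X {i, j}" for i j
    by (rule gauss.indep_vars_compose2[OF gauss_indep]) auto
  have int: "integrable gauss_prod (\<lambda>\<omega>. ?X i \<omega> * ?X j \<omega>)" for i j
    using X1 X2 gauss.indep_vars_integrable[OF _ indep, of i j] by (cases "i = j") auto
  have val: "(\<integral>\<omega>. ?X i \<omega> * ?X j \<omega> \<partial>gauss_prod) = (if i = j then 2 else 0)" for i j
    using X1 X2 gauss.indep_vars_lebesgue_integral[OF _ indep, of i j] by (cases "i = j") auto
  have sq: "(\<lambda>\<omega>. (\<Sum>i\<in>I. ?X i \<omega>)\<^sup>2) = (\<lambda>\<omega>. \<Sum>i\<in>I. \<Sum>j\<in>I. ?X i \<omega> * ?X j \<omega>)"
    by (simp add: power2_eq_square sum_product)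
  show "integrable gauss_prod (\<lambda>\<omega>. (\<Sum>i\<in>I. (\<omega> i)\<^sup>2 - 1)\<^sup>2)"
    unfolding sq by (intro Bochner_Integration.integrable_sum int)
  show "(\<integral>\<omega>. (\<Sum>i\<in>I. (\<omega> i)\<^sup>2 - 1)\<^sup>2 \<partial>gauss_prod) = 2 * real (card I)"
    unfolding sq using assms
    by (simp add: Bochner_Integration.integral_sum Bochner_Integration.integrable_sum int val)
qed

section \<open>The Gaussian measure on \<open>ell2\<close>\<close>

lemma typical_in_sets [measurable]: "typical \<in> sets gauss_prod"
proof -
  have "{\<omega> \<in> space gauss_prod. \<forall>k. \<bar>(\<Sum>i\<in>block k. (\<omega> i)\<^sup>2) - real (block_dim k)\<bar> \<le> real (block_dim k) / 4000}
      \<in> sets gauss_prod"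
    by measurable
  then show ?thesis
    by (simp add: typical_def)
qed

lemma emeasure_typical_pos: "0 < emeasure gauss_prod typical"
proof -
  let ?S = "\<lambda>k \<omega>. \<Sum>i\<in>block k. (\<omega> i)\<^sup>2 - 1"
  let ?A = "\<lambda>k. {\<omega> \<in> space gauss_prod. (real (block_dim k) / 4000)\<^sup>2 \<le> (?S k \<omega>)\<^sup>2}"
  have A_sets: "?A k \<in> sets gauss_prod" for k
    by measurable
  have A_le: "emeasure gauss_prod (?A k) \<le> ennreal (32 / 100 * (1 / 2) ^ k)" for k
  proof -
    have "measure gauss_prod (?A k)
        \<le> (\<integral>\<omega>. (?S k \<omega>)\<^sup>2 \<partial>gauss_prod) / (real (block_dim k) / 4000)\<^sup>2"
    proof (rule integral_Markov_inequality_measure[where A = "space gauss_prod"])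
      show "integrable gauss_prod (\<lambda>\<omega>. (?S k \<omega>)\<^sup>2)"
        by (rule gauss_second_moment(1)) simp
      show "0 < (real (block_dim k) / 4000)\<^sup>2"
        by (intro zero_less_power divide_pos_pos) simp_all
      show "space gauss_prod \<in> sets gauss_prod"
        by (rule sets.top)
    qed simp_all
    also have "\<dots> = 32000000 / real (block_dim k)"
      unfolding gauss_second_moment(2)[OF finite_block] card_block
      using block_dim_pos[of k] by (simp add: power2_eq_square)
    also have "\<dots> = 32 / 100 * (1 / 2) ^ k"
      by (simp add: block_dim_def power_one_over)
    finally show ?thesis
      unfolding gauss.emeasure_eq_measure by (rule ennreal_leI)
  qed
  have cover: "UNIV \<subseteq> typical \<union> (\<Union>k. ?A k)"
  proof
    fix \<omega> :: "nat \<Rightarrow> real"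
    have "\<exists>k. \<omega> \<in> ?A k" if "\<omega> \<notin> typical"
    proof -
      obtain k where "\<not> \<bar>(\<Sum>i\<in>block k. (\<omega> i)\<^sup>2) - real (block_dim k)\<bar> \<le> real (block_dim k) / 4000"
        using \<open>\<omega> \<notin> typical\<close> unfolding typical_def by blast
      then have "\<bar>real (block_dim k) / 4000\<bar> \<le> \<bar>?S k \<omega>\<bar>"
        by (simp add: sum_subtractf)
      then show ?thesis
        unfolding abs_le_square_iff by (intro exI[of _ k]) simp
    qed
    then show "\<omega> \<in> typical \<union> (\<Union>k. ?A k)"
      by blast
  qed
  have sum: "(\<Sum>k. 32 / 100 * (1 / 2) ^ k) = (64 / 100 :: real)"
    by (subst suminf_mult) (simp_all add: suminf_geometric)
  have "emeasure gauss_prod (\<Union>k. ?A k) \<le> (\<Sum>k. emeasure gauss_prod (?A k))"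
    by (rule emeasure_subadditive_countably) (use A_sets in blast)
  also have "\<dots> \<le> (\<Sum>k. ennreal (32 / 100 * (1 / 2) ^ k))"
    by (intro suminf_le A_le) auto
  also have "\<dots> = ennreal (\<Sum>k. 32 / 100 * (1 / 2) ^ k)"
    by (intro suminf_ennreal2 summable_mult summable_geometric) simp_all
  also have "\<dots> = ennreal (64 / 100)"
    by (simp only: sum)
  also have "\<dots> < 1"
    by (simp add: ennreal_less_one_iff)
  finally have lt: "emeasure gauss_prod (\<Union>k. ?A k) < 1" .
  have UN: "(\<Union>k. ?A k) \<in> sets gauss_prod"
    by (intro sets.countable_UN) (use A_sets in blast)
  have "1 = emeasure gauss_prod UNIV"
    using gauss.emeasure_space_1 by simp
  also have "\<dots> \<le> emeasure gauss_prod (typical \<union> (\<Union>k. ?A k))"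
    by (intro emeasure_mono cover sets.Un typical_in_sets UN)
  also have "\<dots> \<le> emeasure gauss_prod typical + emeasure gauss_prod (\<Union>k. ?A k)"
    by (rule emeasure_subadditive[OF typical_in_sets UN])
  finally have "1 \<le> emeasure gauss_prod typical + emeasure gauss_prod (\<Union>k. ?A k)" .
  then show ?thesis
    using lt by (intro zero_less_iff_neq_zero[THEN iffD2] notI) (simp only: add_0 leD)
qed

lemma measurable_ell2I:
  assumes [measurable]: "\<And>i. (\<lambda>\<omega>. ell2_nth (f \<omega>) i) \<in> borel_measurable M"
  shows "f \<in> borel_measurable M"
  by (rule borel_measurable_LIMSEQ_metric[where f = "\<lambda>n \<omega>. \<Sum>i<n. ell2_nth (f \<omega>) i *\<^sub>R ell2_unit i"])
     (simp_all add: ell2_expansion)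

lemma measurable_ell2_nth [measurable]: "(\<lambda>x. ell2_nth x i) \<in> borel_measurable borel"
  by (intro borel_measurable_continuous_onI linear_continuous_on bounded_linear_ell2_nth)

definition weighted_summable :: "(nat \<Rightarrow> real) \<Rightarrow> bool"
  where "weighted_summable \<omega> \<longleftrightarrow> summable (\<lambda>i. coord_var i * (\<omega> i)\<^sup>2)"

text \<open>The value off the null set of non-summable sequences is arbitrary.\<close>

definition gauss_embed :: "(nat \<Rightarrow> real) \<Rightarrow> ell2"
  where "gauss_embed \<omega> = (if weighted_summable \<omega> then Abs_ell2 (\<lambda>i. sqrt (coord_var i) * \<omega> i) else 0)"

definition whiten :: "ell2 \<Rightarrow> nat \<Rightarrow> real"
  where "whiten x i = ell2_nth x i / sqrt (coord_var i)"

lemma ell2_nth_gauss_embed: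
  "ell2_nth (gauss_embed \<omega>) i = (if weighted_summable \<omega> then sqrt (coord_var i) * \<omega> i else 0)"
  by (simp add: gauss_embed_def weighted_summable_def Abs_ell2_inverse power_mult_distrib)

lemma whiten_gauss_embed: "weighted_summable \<omega> \<Longrightarrow> whiten (gauss_embed \<omega>) = \<omega>"
  by (simp add: whiten_def ell2_nth_gauss_embed fun_eq_iff less_imp_neq[OF coord_var_pos, symmetric])

lemma weighted_summable_iff: "weighted_summable \<omega> \<longleftrightarrow> (\<Sum>i. ennreal (coord_var i * (\<omega> i)\<^sup>2)) \<noteq> \<top>"
  unfolding weighted_summable_def
proof
  assume "summable (\<lambda>i. coord_var i * (\<omega> i)\<^sup>2)"
  then have "(\<Sum>i. ennreal (coord_var i * (\<omega> i)\<^sup>2)) = ennreal (\<Sum>i. coord_var i * (\<omega> i)\<^sup>2)"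
    by (intro suminf_ennreal2) simp_all
  then show "(\<Sum>i. ennreal (coord_var i * (\<omega> i)\<^sup>2)) \<noteq> \<top>"
    by simp
next
  assume "(\<Sum>i. ennreal (coord_var i * (\<omega> i)\<^sup>2)) \<noteq> \<top>"
  then show "summable (\<lambda>i. coord_var i * (\<omega> i)\<^sup>2)"
    by (rule summable_suminf_not_top[rotated]) simp
qed

lemma measurable_weighted_summable [measurable]: "Measurable.pred gauss_prod weighted_summable"
  unfolding weighted_summable_iff[abs_def] by measurable

lemma measurable_gauss_embed [measurable]: "gauss_embed \<in> gauss_prod \<rightarrow>\<^sub>M borel"
  by (rule measurable_ell2I) (simp add: ell2_nth_gauss_embed)

lemma AE_weighted_summable: "AE \<omega> in gauss_prod. weighted_summable \<omega>"
proof -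
  have one: "(\<integral>\<^sup>+\<omega>. ennreal ((\<omega> i)\<^sup>2) \<partial>gauss_prod) = 1" for i
  proof -
    have "(\<integral>\<^sup>+\<omega>. ennreal ((\<omega> i)\<^sup>2) \<partial>gauss_prod) = (\<integral>\<^sup>+t. ennreal (t\<^sup>2) \<partial>std_normal_distribution)"
      by (subst distr_gauss_coordinate[of i, symmetric], subst nn_integral_distr) auto
    also have "\<dots> = ennreal (\<integral>t. t\<^sup>2 \<partial>std_normal_distribution)"
      by (intro nn_integral_eq_integral integrable_std_normal_distribution_moment) auto
    finally show ?thesis
      using std_normal_distribution_even_moments(1)[of 1] by simp
  qed
  have "(\<integral>\<^sup>+\<omega>. (\<Sum>i. ennreal (coord_var i * (\<omega> i)\<^sup>2)) \<partial>gauss_prod)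
      = (\<Sum>i. \<integral>\<^sup>+\<omega>. ennreal (coord_var i * (\<omega> i)\<^sup>2) \<partial>gauss_prod)"
    by (rule nn_integral_suminf) measurable
  also have "\<dots> = (\<Sum>i. ennreal (coord_var i))"
    by (simp add: ennreal_mult nn_integral_cmult one)
  also have "\<dots> = ennreal (suminf coord_var)"
    by (intro suminf_ennreal2 summable_coord_var) simp
  finally have "AE \<omega> in gauss_prod. (\<Sum>i. ennreal (coord_var i * (\<omega> i)\<^sup>2)) \<noteq> \<infinity>"
    by (intro nn_integral_PInf_AE) auto
  then show ?thesis
    unfolding weighted_summable_iff by simp
qed

lemma weighted_dist:
  assumes "weighted_summable \<omega>"
  shows "summable (\<lambda>i. coord_var i * (\<omega> i - whiten x i)\<^sup>2)"
    and "(\<Sum>i. coord_var i * (\<omega> i - whiten x i)\<^sup>2) = (dist x (gauss_embed \<omega>))\<^sup>2"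
proof -
  have eq: "coord_var i * (\<omega> i - whiten x i)\<^sup>2 = (ell2_nth (x - gauss_embed \<omega>) i)\<^sup>2" for i
  proof -
    have "sqrt (coord_var i) * (\<omega> i - whiten x i) = - ell2_nth (x - gauss_embed \<omega>) i"
      using assms less_imp_neq[OF coord_var_pos[of i]]
      by (simp add: whiten_def ell2_nth_gauss_embed right_diff_distrib)
    then have "(sqrt (coord_var i) * (\<omega> i - whiten x i))\<^sup>2 = (ell2_nth (x - gauss_embed \<omega>) i)\<^sup>2"
      by (simp only: power2_minus)
    then show ?thesis
      by (simp add: power_mult_distrib)
  qed
  show "summable (\<lambda>i. coord_var i * (\<omega> i - whiten x i)\<^sup>2)"
    unfolding eq by (rule ell2_summable_square)
  show "(\<Sum>i. coord_var i * (\<omega> i - whiten x i)\<^sup>2) = (dist x (gauss_embed \<omega>))\<^sup>2"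
    unfolding eq dist_norm norm_ell2_square ..
qed

definition gauss_ell2 :: "ell2 measure"
  where "gauss_ell2 = distr gauss_prod borel gauss_embed"

definition typical_ell2 :: "ell2 set"
  where "typical_ell2 = {x. whiten x \<in> typical}"

lemma sets_gauss_ell2 [measurable_cong, simp]: "sets gauss_ell2 = sets borel"
  by (simp add: gauss_ell2_def)

lemma space_gauss_ell2 [simp]: "space gauss_ell2 = UNIV"
  by (simp add: gauss_ell2_def)

lemma prob_space_gauss_ell2: "prob_space gauss_ell2"
  unfolding gauss_ell2_def by (rule gauss.prob_space_distr) measurable

lemma typical_ell2_borel [measurable]: "typical_ell2 \<in> sets borel"
proof -
  have "{x \<in> space borel. \<forall>k. \<bar>(\<Sum>i\<in>block k. (whiten x i)\<^sup>2) - real (block_dim k)\<bar> \<le> real (block_dim k) / 4000}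
      \<in> sets borel"
    unfolding whiten_def by measurable
  then show ?thesis
    by (simp add: typical_ell2_def typical_def)
qed

lemma gauss_embed_preimage:
  assumes [measurable]: "A \<in> sets borel"
  shows "{\<omega>. weighted_summable \<omega> \<and> gauss_embed \<omega> \<in> A} \<in> sets gauss_prod"
proof -
  have "{\<omega> \<in> space gauss_prod. weighted_summable \<omega> \<and> gauss_embed \<omega> \<in> A} \<in> sets gauss_prod"
    by measurable
  then show ?thesis
    by simp
qed

lemma emeasure_gauss_ell2:
  assumes [measurable]: "A \<in> sets borel"
  shows "emeasure gauss_ell2 A = emeasure gauss_prod {\<omega>. weighted_summable \<omega> \<and> gauss_embed \<omega> \<in> A}"
proof -
  have "emeasure gauss_ell2 A = emeasure gauss_prod (gauss_embed -` A \<inter> space gauss_prod)"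
    unfolding gauss_ell2_def by (rule emeasure_distr) measurable
  also have "\<dots> = emeasure gauss_prod {\<omega> \<in> space gauss_prod. weighted_summable \<omega> \<and> gauss_embed \<omega> \<in> A}"
  proof (rule emeasure_eq_AE)
    show "AE \<omega> in gauss_prod. \<omega> \<in> gauss_embed -` A \<inter> space gauss_prod \<longleftrightarrow>
        \<omega> \<in> {\<omega> \<in> space gauss_prod. weighted_summable \<omega> \<and> gauss_embed \<omega> \<in> A}"
      using AE_weighted_summable by eventually_elim simp
  qed measurable
  finally show ?thesis
    by simp
qed

lemma emeasure_typical_ell2_pos: "0 < emeasure gauss_ell2 typical_ell2"
proof -
  have "{\<omega>. weighted_summable \<omega> \<and> gauss_embed \<omega> \<in> typical_ell2} = {\<omega> \<in> space gauss_prod. weighted_summable \<omega> \<and> \<omega> \<in> typical}"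
    by (auto simp: typical_ell2_def whiten_gauss_embed)
  then have "emeasure gauss_ell2 typical_ell2 = emeasure gauss_prod {\<omega> \<in> space gauss_prod. weighted_summable \<omega> \<and> \<omega> \<in> typical}"
    by (simp only: emeasure_gauss_ell2[OF typical_ell2_borel])
  also have "\<dots> = emeasure gauss_prod typical"
  proof (rule emeasure_eq_AE)
    show "AE \<omega> in gauss_prod. \<omega> \<in> {\<omega> \<in> space gauss_prod. weighted_summable \<omega> \<and> \<omega> \<in> typical} \<longleftrightarrow> \<omega> \<in> typical"
      using AE_weighted_summable by eventually_elim simp
  qed measurable
  finally show ?thesis
    using emeasure_typical_pos by simp
qed

lemma weighted_summable_escape: "weighted_summable \<omega> \<Longrightarrow> weighted_summable (escape k \<xi> \<omega>)"
  unfolding weighted_summable_def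
  by (subst summable_iff_shift[of _ "block_start (k + 2)", symmetric],
      subst (asm) summable_iff_shift[of _ "block_start (k + 2)", symmetric])
     (simp only: escape_eq(3)[OF le_add2])

lemma ball_typical_le_atypical:
  assumes x: "x \<in> typical_ell2" and r: "0 < r" "r \<le> 1"
  shows "emeasure gauss_ell2 (cball x r \<inter> typical_ell2) \<le> emeasure gauss_ell2 (cball x r - typical_ell2)"
proof -
  define \<xi> where "\<xi> = whiten x"
  have \<xi>: "\<xi> \<in> typical"
    using x by (simp add: \<xi>_def typical_ell2_def)
  obtain k where k: "(1 / 16) ^ (k + 1) \<le> r\<^sup>2" "r\<^sup>2 \<le> (1 / 16) ^ k"
  proof -
    obtain n where n: "(1 / 16) ^ n < r\<^sup>2"
      using real_arch_pow_inv[of "r\<^sup>2" "1 / 16"] r by auto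
    define m where "m = (LEAST n. (1 / 16) ^ n \<le> r\<^sup>2)"
    have m: "(1 / 16) ^ m \<le> r\<^sup>2"
      unfolding m_def by (rule LeastI[of _ n]) (use n in simp)
    show thesis
    proof (cases m)
      case 0
      then have "r\<^sup>2 = 1"
        using m r by (intro antisym) (auto simp: power_le_one)
      then show ?thesis
        using that[of 0] by simp
    next
      case (Suc j)
      then have "\<not> (1 / 16) ^ j \<le> r\<^sup>2"
        using not_less_Least[of j "\<lambda>n. (1 / 16) ^ n \<le> r\<^sup>2"] by (simp add: m_def)
      then show ?thesis
        using that[of j] m Suc by simp
    qed
  qed
  define d where "d i = escape_shift k i * \<xi> i" for i
  define S where "S \<omega> i = (\<omega> i - d i) / escape_scale k i" for \<omega> :: "nat \<Rightarrow> real" and i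
  define E where "E = {\<omega>. weighted_summable \<omega> \<and> gauss_embed \<omega> \<in> cball x r \<inter> typical_ell2}"
  have scale_pos: "0 < escape_scale k i" for i
    by (simp add: escape_scale_def)
  have E [measurable]: "E \<in> sets gauss_prod"
    unfolding E_def by (intro gauss_embed_preimage sets.Int typical_ell2_borel) simp
  have S [measurable]: "S \<in> gauss_prod \<rightarrow>\<^sub>M gauss_prod"
    unfolding measurable_cong_sets[OF refl sets_gauss_prod]
    by (rule measurable_PiM_single') (auto simp: S_def)
  have ED: "\<omega> \<in> typical" "weighted_summable \<omega>" "(\<Sum>i. coord_var i * (\<omega> i - \<xi> i)\<^sup>2) \<le> r\<^sup>2"
    if "\<omega> \<in> E" for \<omega>
    using that weighted_dist(2)[of \<omega> x] whiten_gauss_embed[of \<omega>]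
    by (auto simp: E_def \<xi>_def typical_ell2_def intro!: power_mono)
  have sm: "summable (\<lambda>i. coord_var i * (\<omega> i - \<xi> i)\<^sup>2)" if "\<omega> \<in> E" for \<omega>
    unfolding \<xi>_def using ED(2)[OF that] by (rule weighted_dist(1))
  have Z: "(\<Sum>i\<in>block k. (\<omega> i - \<xi> i)\<^sup>2) \<le> real (block_dim k)" if "\<omega> \<in> E" for \<omega>
    using block_dist_le[OF sm[OF that] ED(3)[OF that] k(2)] .
  have "emeasure gauss_prod E \<le> emeasure (distr gauss_prod gauss_prod S) E"
  proof -
    have eq: "distr gauss_prod gauss_prod S
        = density gauss_prod (\<lambda>\<omega>. ennreal (\<Prod>i<block_start (k + 2). affine_density (escape_scale k i) (d i) (\<omega> i)))"
      unfolding S_def by (rule distr_gauss_affine) (auto simp: scale_pos d_def escape_scale_def escape_shift_def)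
    have "emeasure gauss_prod E = (\<integral>\<^sup>+\<omega>. indicator E \<omega> \<partial>gauss_prod)"
      by (rule nn_integral_indicator[OF E, symmetric])
    also have "\<dots> \<le> (\<integral>\<^sup>+\<omega>. ennreal (\<Prod>i<block_start (k + 2). affine_density (escape_scale k i) (d i) (\<omega> i)) * indicator E \<omega> \<partial>gauss_prod)"
    proof (rule nn_integral_mono)
      fix \<omega> :: "nat \<Rightarrow> real"
      have "1 \<le> (\<Prod>i<block_start (k + 2). affine_density (escape_scale k i) (d i) (\<omega> i))" if "\<omega> \<in> E"
        using escape_density_ge_1[OF \<xi> ED(1)[OF that] Z[OF that]]
        by (simp only: escape_density_def escape_def affine_density_def d_def)
      then show "indicator E \<omega> \<le> ennreal (\<Prod>i<block_start (k + 2). affine_density (escape_scale k i) (d i) (\<omega> i)) * indicator E \<omega>"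
        by (cases "\<omega> \<in> E") simp_all
    qed
    also have "\<dots> = emeasure (distr gauss_prod gauss_prod S) E"
      unfolding eq by (subst emeasure_density) (use E in auto)
    finally show ?thesis .
  qed
  also have "\<dots> = emeasure gauss_prod (S -` E \<inter> space gauss_prod)"
    by (rule emeasure_distr) measurable
  also have "\<dots> \<le> emeasure gauss_prod {\<omega>. weighted_summable \<omega> \<and> gauss_embed \<omega> \<in> cball x r - typical_ell2}"
  proof (rule emeasure_mono)
    show "S -` E \<inter> space gauss_prod \<subseteq> {\<omega>. weighted_summable \<omega> \<and> gauss_embed \<omega> \<in> cball x r - typical_ell2}"
    proof
      fix \<omega>
      assume "\<omega> \<in> S -` E \<inter> space gauss_prod"
      then have SE: "S \<omega> \<in> E"
        by simp
      have \<omega>: "\<omega> = escape k \<xi> (S \<omega>)"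
        using less_imp_neq[OF scale_pos] by (auto simp: fun_eq_iff escape_def S_def d_def)
      have sum: "weighted_summable \<omega>"
        by (subst \<omega>) (rule weighted_summable_escape[OF ED(2)[OF SE]])
      have "\<omega> \<notin> typical"
        by (subst \<omega>) (rule escape_not_typical[OF \<xi> ED(1)[OF SE] Z[OF SE]])
      then have "gauss_embed \<omega> \<notin> typical_ell2"
        using sum by (simp add: typical_ell2_def whiten_gauss_embed)
      moreover have "(\<Sum>i. coord_var i * (\<omega> i - \<xi> i)\<^sup>2) \<le> r\<^sup>2"
        by (subst \<omega>) (rule escape_near[OF \<xi> ED(1)[OF SE] sm[OF SE] ED(3)[OF SE] k])
      then have "(dist x (gauss_embed \<omega>))\<^sup>2 \<le> r\<^sup>2"
        using weighted_dist(2)[OF sum, of x] by (simp add: \<xi>_def)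
      then have "dist x (gauss_embed \<omega>) \<le> r"
        by (rule power2_le_imp_le) (use r in simp)
      ultimately show "\<omega> \<in> {\<omega>. weighted_summable \<omega> \<and> gauss_embed \<omega> \<in> cball x r - typical_ell2}"
        using sum by simp
    qed
  qed (intro gauss_embed_preimage sets.Diff typical_ell2_borel, simp)
  finally show ?thesis
    by (subst (1 2) emeasure_gauss_ell2) (simp_all add: E_def sets.Int sets.Diff)
qed

lemma gaussian_ell2: "gaussian_measure gauss_ell2"
  unfolding gaussian_measure_def
proof (intro conjI allI impI prob_space_gauss_ell2 sets_gauss_ell2)
  fix l :: "ell2 \<Rightarrow> real"
  assume "bounded_linear l"
  then interpret l: bounded_linear l .
  have l_meas [measurable]: "l \<in> borel_measurable borel"
    by (intro borel_measurable_continuous_onI linear_continuous_on \<open>bounded_linear l\<close>)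
  obtain K where K: "\<And>x. norm (l x) \<le> norm x * K" "0 < K"
    using l.pos_bounded by blast
  define c where "c i = l (ell2_unit i)" for i
  define a where "a i = c i * sqrt (coord_var i)" for i
  define V where "V = (\<Sum>i. (a i)\<^sup>2)"
  have "(a i)\<^sup>2 \<le> K\<^sup>2 * coord_var i" for i
  proof -
    have "(c i)\<^sup>2 \<le> K\<^sup>2"
      using K(1)[of "ell2_unit i"] K(2) by (intro power2_le_iff_abs_le[THEN iffD2]) (simp_all add: c_def)
    then show ?thesis
      by (simp add: a_def power_mult_distrib mult_right_mono)
  qed
  then have sm_a: "summable (\<lambda>i. (a i)\<^sup>2)"
    by (intro summable_comparison_test'[OF summable_mult[OF summable_coord_var, of "K\<^sup>2"], of 0]) simp
  have V: "0 \<le> V"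
    unfolding V_def by (intro suminf_nonneg sm_a) simp
  have expand: "(\<lambda>n. \<Sum>i<n. a i * \<omega> i) \<longlonglongrightarrow> l (gauss_embed \<omega>)" if "weighted_summable \<omega>" for \<omega>
  proof -
    have "(\<lambda>n. l (\<Sum>i<n. ell2_nth (gauss_embed \<omega>) i *\<^sub>R ell2_unit i)) \<longlonglongrightarrow> l (gauss_embed \<omega>)"
      by (intro l.tendsto ell2_expansion)
    then show ?thesis
      using that by (simp add: l.sum l.scaleR ell2_nth_gauss_embed a_def c_def mult_ac)
  qed
  have char_coord: "char (distr gauss_prod borel (\<lambda>\<omega>. b * \<omega> i)) t = of_real (exp (- (b * t)\<^sup>2 / 2))" for b t i
  proof -
    have "char (distr gauss_prod borel (\<lambda>\<omega>. b * \<omega> i)) t = (CLINT \<omega>|gauss_prod. iexp (t * (b * \<omega> i)))"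
      unfolding char_def by (rule integral_distr) auto
    also have "\<dots> = (CLINT \<omega>|gauss_prod. iexp ((b * t) * \<omega> i))"
      by (simp add: mult_ac)
    also have "\<dots> = (CLINT x|std_normal_distribution. iexp ((b * t) * x))"
      unfolding distr_gauss_coordinate[of i, symmetric] by (rule integral_distr[symmetric]) auto
    also have "\<dots> = char std_normal_distribution (b * t)"
      by (simp add: char_def)
    finally show ?thesis
      by (simp add: char_std_normal_distribution)
  qed
  have char_sum: "(CLINT \<omega>|gauss_prod. iexp (t * (\<Sum>i<n. a i * \<omega> i))) = of_real (exp (- t\<^sup>2 / 2 * (\<Sum>i<n. (a i)\<^sup>2)))"
    for n t
  proof -
    have indep: "gauss.indep_vars (\<lambda>_. borel) (\<lambda>i \<omega>. a i * \<omega> i) {..<n}"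
      by (rule gauss.indep_vars_subset[OF gauss.indep_vars_compose2[OF gauss_indep, of UNIV]]) auto
    have "(CLINT \<omega>|gauss_prod. iexp (t * (\<Sum>i<n. a i * \<omega> i)))
        = char (distr gauss_prod borel (\<lambda>\<omega>. \<Sum>i<n. a i * \<omega> i)) t"
      unfolding char_def by (rule integral_distr[symmetric]) auto
    also have "\<dots> = (\<Prod>i<n. of_real (exp (- (a i * t)\<^sup>2 / 2)))"
      unfolding gauss.char_distr_sum[OF indep] char_coord ..
    also have "\<dots> = of_real (exp (\<Sum>i<n. - (a i * t)\<^sup>2 / 2))"
      by (simp add: exp_sum)
    also have "(\<Sum>i<n. - (a i * t)\<^sup>2 / 2) = - t\<^sup>2 / 2 * (\<Sum>i<n. (a i)\<^sup>2)"
      by (simp add: sum_distrib_left power_mult_distrib mult_ac)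
    finally show ?thesis .
  qed
  have char_l: "char (distr gauss_ell2 borel l) t = of_real (exp (- t\<^sup>2 / 2 * V))" for t
  proof (rule LIMSEQ_unique)
    have "char (distr gauss_ell2 borel l) t = (CLINT \<omega>|gauss_prod. iexp (t * l (gauss_embed \<omega>)))"
      unfolding char_def gauss_ell2_def
      by (subst distr_distr, measurable, subst integral_distr, auto)
    moreover have "(\<lambda>n. CLINT \<omega>|gauss_prod. iexp (t * (\<Sum>i<n. a i * \<omega> i)))
        \<longlonglongrightarrow> (CLINT \<omega>|gauss_prod. iexp (t * l (gauss_embed \<omega>)))"
    proof (rule integral_dominated_convergence[where w = "\<lambda>_. 1"])
      show "AE \<omega> in gauss_prod. (\<lambda>n. iexp (t * (\<Sum>i<n. a i * \<omega> i))) \<longlonglongrightarrow> iexp (t * l (gauss_embed \<omega>))"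
        using AE_weighted_summable
      proof eventually_elim
        case (elim \<omega>)
        show ?case
          by (intro tendsto_intros expand elim)
      qed
    qed (auto simp del: of_real_mult of_real_sum)
    ultimately show "(\<lambda>n. CLINT \<omega>|gauss_prod. iexp (t * (\<Sum>i<n. a i * \<omega> i))) \<longlonglongrightarrow> char (distr gauss_ell2 borel l) t"
      by simp
    show "(\<lambda>n. CLINT \<omega>|gauss_prod. iexp (t * (\<Sum>i<n. a i * \<omega> i))) \<longlonglongrightarrow> of_real (exp (- t\<^sup>2 / 2 * V))"
      unfolding char_sum V_def by (intro tendsto_intros summable_LIMSEQ sm_a)
  qed
  have real_l: "real_distribution (distr gauss_ell2 borel l)"
    by (intro prob_space.real_distribution_distr prob_space_gauss_ell2) measurable
  show "(\<exists>m. distr gauss_ell2 borel l = return borel m) \<or>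
      (\<exists>m \<sigma>. 0 < \<sigma> \<and> distr gauss_ell2 borel l = density lborel (\<lambda>t. ennreal (normal_density m \<sigma> t)))"
  proof (cases "V = 0")
    case True
    have "distr gauss_ell2 borel l = return borel 0"
    proof (rule Levy_uniqueness[OF real_l])
      show "real_distribution (return borel (0 :: real))"
        by (simp add: real_distribution_def real_distribution_axioms_def prob_space_return)
      show "char (distr gauss_ell2 borel l) = char (return borel 0)"
        using True by (simp add: fun_eq_iff char_l) (simp add: char_def integral_return)
    qed
    then show ?thesis
      by blast
  next
    case False
    have N: "prob_space std_normal_distribution"
      by (rule prob_space_normal_density) simp
    have "distributed std_normal_distribution lborel (\<lambda>x. x) std_normal_density"
      by (simp add: distributed_def distr_id2)
    from prob_space.normal_density_affine[OF N this, of "sqrt V" 0]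
    have dens: "distr std_normal_distribution lborel (\<lambda>x. sqrt V * x) = density lborel (normal_density 0 (sqrt V))"
      using V False by (simp add: distributed_def)
    have lb: "distr std_normal_distribution lborel (\<lambda>x. sqrt V * x) = distr std_normal_distribution borel (\<lambda>x. sqrt V * x)"
      by (intro distr_cong) simp_all
    have "distr gauss_ell2 borel l = distr std_normal_distribution borel (\<lambda>x. sqrt V * x)"
    proof (rule Levy_uniqueness[OF real_l])
      show "real_distribution (distr std_normal_distribution borel (\<lambda>x. sqrt V * x))"
        by (intro prob_space.real_distribution_distr[OF N]) simp
      have "char (distr std_normal_distribution borel (\<lambda>x. sqrt V * x)) t = of_real (exp (- t\<^sup>2 / 2 * V))" for t
      proof -
        have "char (distr std_normal_distribution borel (\<lambda>x. sqrt V * x)) t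
            = (CLINT x|std_normal_distribution. iexp ((t * sqrt V) * x))"
          unfolding char_def by (subst integral_distr) (auto simp: mult_ac)
        also have "\<dots> = char std_normal_distribution (t * sqrt V)"
          by (simp add: char_def)
        finally show ?thesis
          using V by (simp add: char_std_normal_distribution power_mult_distrib)
      qed
      then show "char (distr gauss_ell2 borel l) = char (distr std_normal_distribution borel (\<lambda>x. sqrt V * x))"
        by (simp add: fun_eq_iff char_l)
    qed
    then show ?thesis
      using dens V False unfolding lb by (intro disjI2 exI[of _ 0] exI[of _ "sqrt V"]) simp
  qed
qed

lemma metric_measure_space_gauss_ell2: "metric_measure_space gauss_ell2"
proof -
  interpret prob_space gauss_ell2
    by (rule prob_space_gauss_ell2)
  show ?thesis
    unfolding metric_measure_space_def
    using emeasure_space_1 emeasure_finite second_countable_imp_tau_additive[OF sets_gauss_ell2]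
    by (auto simp: less_top[symmetric] intro!: exI[of _ gauss_ell2])
qed

section \<open>The centered maximal function\<close>

lemma null_balls_in_null_open:
  fixes \<mu> :: "'a::{metric_space, second_countable_topology} measure"
  assumes sets: "sets \<mu> = sets borel" and "0 < r"
  obtains U where "open U" "emeasure \<mu> U = 0" "{x. emeasure \<mu> (cball x r) = 0} \<subseteq> U"
proof -
  let ?N = "{x. emeasure \<mu> (cball x r) = 0}"
  have null: "ball x r \<in> null_sets \<mu>" if "x \<in> ?N" for x
  proof -
    have "emeasure \<mu> (ball x r) \<le> emeasure \<mu> (cball x r)"
      by (intro emeasure_mono ball_subset_cball) (simp add: sets)
    then show ?thesis
      using that by (auto simp: null_sets_def sets)
  qed
  obtain \<C> where \<C>: "\<C> \<subseteq> (\<lambda>x. ball x r) ` ?N" "countable \<C>" "\<Union>\<C> = (\<Union>x\<in>?N. ball x r)"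
    using Lindelof[of "(\<lambda>x. ball x r) ` ?N"] by force
  have "\<Union>\<C> \<in> null_sets \<mu>"
    using null_sets_UN'[OF \<C>(2), of "\<lambda>B. B" \<mu>] \<C>(1) null by auto
  then have "emeasure \<mu> (\<Union>x\<in>?N. ball x r) = 0"
    unfolding \<C>(3) by auto
  moreover have "?N \<subseteq> (\<Union>x\<in>?N. ball x r)"
    using \<open>0 < r\<close> centre_in_ball[of _ r] by blast
  ultimately show thesis
    using that[of "\<Union>x\<in>?N. ball x r"] by blast
qed

lemma centered_maximal_indicator_less:
  assumes prob: "prob_space \<mu>" and sets: "sets \<mu> = sets borel" and C: "C \<in> sets borel"
    and pos: "0 < R" "0 < emeasure \<mu> (cball x R)"
    and half: "\<And>r. 0 < r \<Longrightarrow> r \<le> R \<Longrightarrow> emeasure \<mu> (cball x r \<inter> C) \<le> emeasure \<mu> (cball x r - C)"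
  shows "centered_maximal \<mu> (indicator C) x < 1"
proof -
  interpret prob_space \<mu>
    by (rule prob)
  have [simp]: "cball x r \<in> events" "C \<in> events" for r
    using C by (simp_all add: sets)
  have split: "prob (cball x r) = prob (cball x r \<inter> C) + prob (cball x r - C)" for r
    using finite_measure_Diff'[of "cball x r" C] by simp
  have half': "prob (cball x r \<inter> C) \<le> prob (cball x r - C)" if "0 < r" "r \<le> R" for r
    using half[OF that] by (simp add: emeasure_eq_measure)
  define \<delta> where "\<delta> = prob (cball x R - C)"
  have "0 < prob (cball x R)"
    using pos(2) by (simp add: emeasure_eq_measure)
  then have \<delta>: "0 < \<delta>" "\<delta> \<le> 1"
    using split[of R] half'[of R] pos(1) by (auto simp: \<delta>_def)
  have ratio: "prob (cball x r \<inter> C) / prob (cball x r) \<le> max (1 / 2) (1 - \<delta>)"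
    if r: "0 < r" "0 < prob (cball x r)" for r
  proof (cases "r \<le> R")
    case True
    then have "prob (cball x r \<inter> C) / prob (cball x r) \<le> 1 / 2"
      using split[of r] half'[OF r(1)] r(2) by (simp add: divide_le_eq)
    then show ?thesis
      by (rule max.coboundedI1)
  next
    case False
    then have "\<delta> \<le> prob (cball x r - C)"
      unfolding \<delta>_def by (intro finite_measure_mono Diff_mono subset_cball) auto
    moreover have "\<delta> * prob (cball x r) \<le> \<delta>"
      using \<delta> by (simp add: mult_left_le)
    ultimately have "prob (cball x r \<inter> C) \<le> (1 - \<delta>) * prob (cball x r)"
      using split[of r] by (simp add: algebra_simps)
    then have "prob (cball x r \<inter> C) / prob (cball x r) \<le> 1 - \<delta>"
      using r(2) by (simp add: divide_le_eq)
    then show ?thesis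
      by (rule max.coboundedI2)
  qed
  have "centered_maximal \<mu> (indicator C) x \<le> ennreal (max (1 / 2) (1 - \<delta>))"
    unfolding centered_maximal_def
  proof (rule SUP_least)
    fix r
    assume "r \<in> {r. 0 < r \<and> 0 < emeasure \<mu> (cball x r)}"
    then have r: "0 < r" "0 < prob (cball x r)"
      by (auto simp: emeasure_eq_measure)
    have "(\<integral>\<^sup>+y\<in>cball x r. ennreal \<bar>indicator C y\<bar> \<partial>\<mu>) = (\<integral>\<^sup>+y. indicator (cball x r \<inter> C) y \<partial>\<mu>)"
      by (intro nn_integral_cong) (auto simp: indicator_def)
    also have "\<dots> = ennreal (prob (cball x r \<inter> C))"
      by (subst nn_integral_indicator) (simp_all add: emeasure_eq_measure sets.Int)
    finally have "(\<integral>\<^sup>+y\<in>cball x r. ennreal \<bar>indicator C y\<bar> \<partial>\<mu>) / emeasure \<mu> (cball x r)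
        = ennreal (prob (cball x r \<inter> C) / prob (cball x r))"
      using r by (simp add: emeasure_eq_measure divide_ennreal)
    then show "(\<integral>\<^sup>+y\<in>cball x r. ennreal \<bar>indicator C y\<bar> \<partial>\<mu>) / emeasure \<mu> (cball x r) \<le> ennreal (max (1 / 2) (1 - \<delta>))"
      using ratio[OF r] by (simp add: ennreal_leI)
  qed
  also have "\<dots> < 1"
    using \<delta> by (subst ennreal_less_one_iff) auto
  finally show ?thesis .
qed

theorem corollary4p1:
  shows "Topological_Spaces.complete (UNIV :: ell2 set) \<and>
    separable_space (euclidean :: ell2 topology) \<and>
    \<not> (\<exists>B :: ell2 set. finite B \<and> span B = UNIV) \<and>
    (\<exists>(\<mu> :: ell2 measure) (f :: ell2 \<Rightarrow> real).
      gaussian_measure \<mu> \<and> metric_measure_space \<mu> \<and> integrable \<mu> f \<and>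
      (\<exists>A\<in>sets \<mu>. 0 < emeasure \<mu> A \<and> (\<forall>x\<in>A. centered_maximal \<mu> f x < ennreal \<bar>f x\<bar>)))"
proof (intro conjI separable_ell2 infinite_dimensional_ell2 exI[of _ gauss_ell2]
    exI[of _ "indicator typical_ell2"] gaussian_ell2 metric_measure_space_gauss_ell2)
  interpret prob_space gauss_ell2
    by (rule prob_space_gauss_ell2)
  show "Topological_Spaces.complete (UNIV :: ell2 set)"
    by (rule complete_UNIV)
  show "integrable gauss_ell2 (indicator typical_ell2 :: ell2 \<Rightarrow> real)"
    by (rule integrable_real_indicator) (simp_all add: less_top[symmetric])
  obtain U where U: "open U" "emeasure gauss_ell2 U = 0" "{x. emeasure gauss_ell2 (cball x 1) = 0} \<subseteq> U"
    by (rule null_balls_in_null_open[OF sets_gauss_ell2 zero_less_one])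
  show "\<exists>A\<in>sets gauss_ell2. 0 < emeasure gauss_ell2 A \<and>
      (\<forall>x\<in>A. centered_maximal gauss_ell2 (indicator typical_ell2) x < ennreal \<bar>indicator typical_ell2 x\<bar>)"
  proof (intro bexI conjI ballI)
    show "typical_ell2 - U \<in> sets gauss_ell2"
      using U(1) by (simp add: sets.Diff)
    have "emeasure gauss_ell2 (typical_ell2 - U) = emeasure gauss_ell2 typical_ell2"
      by (rule emeasure_Diff_null_set) (use U in \<open>auto simp: null_sets_def\<close>)
    then show "0 < emeasure gauss_ell2 (typical_ell2 - U)"
      using emeasure_typical_ell2_pos by simp
  next
    fix x
    assume x: "x \<in> typical_ell2 - U"
    then have "0 < emeasure gauss_ell2 (cball x 1)"
      using U(3) by (auto simp: zero_less_iff_neq_zero)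
    then have "centered_maximal gauss_ell2 (indicator typical_ell2) x < 1"
      using x by (intro centered_maximal_indicator_less[where R = 1] prob_space_axioms ball_typical_le_atypical) auto
    then show "centered_maximal gauss_ell2 (indicator typical_ell2) x < ennreal \<bar>indicator typical_ell2 x\<bar>"
      using x by simp
  qed
qed

end
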